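(* Let $G$ be an $n$-dimensional torus, let $\Gamma$ be a finite $d$-valent graph with vertex set $V$ equipped with a GKM action of $G$, let $T\subset G$ be a circle subgroup not contained in any $G_e$, with infinitesimal generator $\xi$, let $\phi:V\to\mathbb R$ be a $T$-moment map, let $c\in\mathbb R$ be a regular value of $\phi$, and let $f\in K_G(\Gamma)$. Then the sum $$\chi_c(f)=\sum_{e\in V_c}f_c^{\#}(e)$$ is in $R(G/T)$.
   Context: Torus notation. $\mathfrak g$ is the Lie algebra of $G$, $\mathbb Z_G=\ker(\exp:\mathfrak g\to G)$, and $\mathbb Z_G^*=\{\alpha\in\mathfrak g^*:\alpha(v)\in\mathbb Z\text{ for all }v\in\mathbb Z_G\}$ is the weight lattice. For $\alpha\in\mathbb Z_G^*$, $e^{2\pi i\alpha}:G\to S^1$ is the character $\exp(x)\mapsto e^{2\pi i\alpha(x)}$. For a compact commutative Lie group $H$, $R(H)$ is the representation ring, identified with the character ring: all finite sums $\sum m_k\chi_k$ with $m_k\in\mathbb Z$ and $\chi_k:H\to S^1$ characters. Graph and action. $E$ is the set of oriented edges of $\Gamma$ (each unoriented edge gives two oriented edges). For $e\in E$, $i(e)$ and $t(e)$ are its initial and terminal vertices and $\bar e$ is $e$ with reversed orientation. $d$-valent means each vertex $p$ has exactly $d$ oriented edges $e$ with $i(e)=p$. An action of $G$ on $\Gamma$ assigns to each $e\in E$ a one-dimensional representation $\varrho_e$ with character $\chi_e=e^{2\pi i\alpha_e}$, $\alpha_e\in\mathbb Z_G^*$, and to each $p\in V$ a $d$-dimensional representation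 $\tau_p$, such that, with $G_e=\ker\chi_e$: $\tau_p\simeq\bigoplus_{i(e)=p}\varrho_e$ for all $p$; $\varrho_{\bar e}\simeq\varrho_e^*$ (so $\alpha_{\bar e}=-\alpha_e$); and $\tau_{i(e)}|_{G_e}\simeq\tau_{t(e)}|_{G_e}$ for all $e$. The action is GKM if for any two distinct oriented edges $e_1\ne e_2$ with $i(e_1)=i(e_2)$ the weights $\alpha_{e_1},\alpha_{e_2}$ are linearly independent. $K_G(\Gamma)$ is the set of functions $f:V\to R(G)$, $p\mapsto f_p$, with $r_e f_{i(e)}=r_e f_{t(e)}$ for every edge $e$, where $r_e:R(G)\to R(G_e)$ is restriction. Circle and moment map. The infinitesimal generator $\xi$ is a basis vector of the group lattice $\mathbb Z_T=\ker(\exp:\mathfrak t\to T)$ of $T$; since $T\not\subset G_e$, $\alpha_e(\xi)\ne0$ for all $e$. A $T$-moment map is a function $\phi:V\to\mathbb R$ with $\frac{\phi(t(e))-\phi(i(e))}{\alpha_e(\xi)}>0$ for all $e\in E$. A regular value $c$ is a real number not of the form $\phi(p)$. $V_c$ is the set of oriented edges $e$ with $\phi(t(e))>c>\phi(i(e))$. Definition of $f_c^{\#}(e)$. For $e\in V_c$ let $p=i(e)$ and $\hat f_e=f_p\prod_{e'}(1-e^{2\pi i\alpha_{e'}})^{-1}$, the product over all $e'\ne e$ with $i(e')=p$. Let $\pi_e:G_e\to G/T$ be the composition of the inclusion $G_e\to G$ with the projection $G\to G/T$; it is surjective with finite kernel $W_e=G_e\cap T$. The push-forward $(\pi_e)_*:R(G_e)\to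 R(G/T)$ sends a representation to its $W_e$-invariant part regarded as a representation of $G_e/W_e=G/T$; on characters, $((\pi_e)_*h)(\bar g)=\frac1{|W_e|}\sum_{w\in W_e}h(gw)$ for any $g\in G_e$ with $\pi_e(g)=\bar g$. This formula extends $(\pi_e)_*$ to quotients such as $r_e\hat f_e$ (the restriction of $\hat f_e$ to $G_e$, a quotient whose denominator is not identically zero on any component of $G_e$), giving functions defined generically on $G/T$. Put $f_c^{\#}(e)=(\pi_e)_*r_e\hat f_e$, an element of a quotient ring of $R(G/T)$. The assertion that $\chi_c(f)$ is in $R(G/T)$ means that this generically defined function is given by an element of $R(G/T)$. *)

theory Defs
  imports
    "HOL-Analysis.Analysis"
    "HOL-Algebra.Coset"
    "Jordan_Normal_Form.Matrix"
    "Graph_Theory.Bidirected_Digraph"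
begin

section \<open>Tori and circle subgroups\<close>

definition circle_group :: "complex monoid" where
  "circle_group = \<lparr>carrier = sphere 0 1, mult = (*), one = 1\<rparr>"

definition int_span :: "'a::real_vector set \<Rightarrow> 'a set" where
  "int_span B = {\<Sum>b\<in>B. real_of_int (m b) *\<^sub>R b | m. True}"

text \<open>The group lattice of the whole group, i.e. the kernel of the exponential map.\<close>

definition exp_kernel :: "('g, 'm) monoid_scheme \<Rightarrow> ('a \<Rightarrow> 'g) \<Rightarrow> 'a set" where
  "exp_kernel G ex = {x. ex x = \<one>\<^bsub>G\<^esub>}"

text \<open>
  A topological group \<open>(G, X)\<close> that is an \<open>n\<close>-dimensional torus with Lie algebra \<open>'a\<close> and
  exponential map \<open>ex\<close>: as a topological group it is the quotient, via \<open>ex\<close>, of the Lie algebra by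
  a lattice of full rank. The inner product of \<open>'a\<close> plays no role.
\<close>

definition torus ::
  "nat \<Rightarrow> ('g, 'm) monoid_scheme \<Rightarrow> 'g topology \<Rightarrow> ('a::euclidean_space \<Rightarrow> 'g) \<Rightarrow> bool" where
  "torus n G X ex \<longleftrightarrow>
     DIM('a) = n \<and>
     comm_group G \<and> topspace X = carrier G \<and>
     (\<forall>x y. ex (x + y) = ex x \<otimes>\<^bsub>G\<^esub> ex y) \<and>
     quotient_map euclidean X ex \<and>
     (\<exists>B. independent B \<and> span B = UNIV \<and> exp_kernel G ex = int_span B)"

definition circle_subgroup ::
  "('g, 'm) monoid_scheme \<Rightarrow> 'g topology \<Rightarrow> 'g set \<Rightarrow> bool" where
  "circle_subgroup G X T \<longleftrightarrow>
     subgroup T G \<and>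
     (\<exists>\<iota>. \<iota> \<in> iso circle_group (G\<lparr>carrier := T\<rparr>) \<and>
          homeomorphic_map (top_of_set (sphere 0 1)) (subtopology X T) \<iota>)"

definition lie_subalgebra :: "('a::real_vector \<Rightarrow> 'g) \<Rightarrow> 'g set \<Rightarrow> 'a set" where
  "lie_subalgebra ex T = {x. \<forall>t::real. ex (t *\<^sub>R x) \<in> T}"

definition infinitesimal_generator ::
  "('g, 'm) monoid_scheme \<Rightarrow> ('a::real_vector \<Rightarrow> 'g) \<Rightarrow> 'g set \<Rightarrow> 'a \<Rightarrow> bool" where
  "infinitesimal_generator G ex T \<xi> \<longleftrightarrow>
     \<xi> \<noteq> 0 \<and> lie_subalgebra ex T \<inter> exp_kernel G ex = range (\<lambda>k::int. real_of_int k *\<^sub>R \<xi>)"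

definition weight_lattice ::
  "('g, 'm) monoid_scheme \<Rightarrow> ('a::real_normed_vector \<Rightarrow> 'g) \<Rightarrow> ('a \<Rightarrow>\<^sub>L real) set" where
  "weight_lattice G ex = {\<alpha>. \<forall>v\<in>exp_kernel G ex. blinfun_apply \<alpha> v \<in> \<int>}"

text \<open>The character \<open>ex x \<mapsto> e\<^bsup>2\<pi>i\<alpha>(x)\<^esup>\<close>; for a weight \<open>\<alpha>\<close> the choice of the logarithm is immaterial.\<close>

definition weight_char ::
  "('a::real_normed_vector \<Rightarrow> 'g) \<Rightarrow> ('a \<Rightarrow>\<^sub>L real) \<Rightarrow> 'g \<Rightarrow> complex" where
  "weight_char ex \<alpha> g = cis (2 * pi * blinfun_apply \<alpha> (SOME x. ex x = g))"


section \<open>Character rings\<close>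

definition characters :: "('h, 'm) monoid_scheme \<Rightarrow> 'h topology \<Rightarrow> ('h \<Rightarrow> complex) set" where
  "characters H X = {\<psi> \<in> hom H circle_group. continuous_map X euclidean \<psi>}"

text \<open>
  The elements of \<open>rep_ring H X\<close> are functions on \<open>carrier H\<close> (extended by \<open>undefined\<close>), so that
  equality in the ring is equality of functions and restriction to a subgroup is \<^const>\<open>restrict\<close>.
\<close>

definition rep_ring :: "('h, 'm) monoid_scheme \<Rightarrow> 'h topology \<Rightarrow> ('h \<Rightarrow> complex) set" where
  "rep_ring H X =
     {\<lambda>x\<in>carrier H. \<Sum>k<N. of_int (m k) * \<psi> k x | (N::nat) (m::nat \<Rightarrow> int) \<psi>.
        \<forall>k<N. \<psi> k \<in> characters H X}"

definition quotient_top :: "'g topology \<Rightarrow> ('g \<Rightarrow> 'h) \<Rightarrow> 'h topology" where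
  "quotient_top X \<pi> =
     topology (\<lambda>U. U \<subseteq> \<pi> ` topspace X \<and> openin X {x \<in> topspace X. \<pi> x \<in> U})"

lemma openin_quotient_top:
  "openin (quotient_top X \<pi>) U \<longleftrightarrow> U \<subseteq> \<pi> ` topspace X \<and> openin X {x \<in> topspace X. \<pi> x \<in> U}"
proof -
  have "istopology (\<lambda>U. U \<subseteq> \<pi> ` topspace X \<and> openin X {x \<in> topspace X. \<pi> x \<in> U})"
    unfolding istopology_def
  proof (rule conjI; intro allI impI conjI)
    fix S T assume S: "S \<subseteq> \<pi> ` topspace X \<and> openin X {x \<in> topspace X. \<pi> x \<in> S}"
      and T: "T \<subseteq> \<pi> ` topspace X \<and> openin X {x \<in> topspace X. \<pi> x \<in> T}"
    have "{x \<in> topspace X. \<pi> x \<in> S \<inter> T}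
        = {x \<in> topspace X. \<pi> x \<in> S} \<inter> {x \<in> topspace X. \<pi> x \<in> T}" by blast
    then show "openin X {x \<in> topspace X. \<pi> x \<in> S \<inter> T}"
      using openin_Int[OF conjunct2[OF S] conjunct2[OF T]] by (simp only:)
    show "S \<inter> T \<subseteq> \<pi> ` topspace X" using S by blast
  next
    fix K assume K: "\<forall>S\<in>K. S \<subseteq> \<pi> ` topspace X \<and> openin X {x \<in> topspace X. \<pi> x \<in> S}"
    have eq: "{x \<in> topspace X. \<pi> x \<in> \<Union> K} = \<Union> ((\<lambda>S. {x \<in> topspace X. \<pi> x \<in> S}) ` K)" by blast
    show "openin X {x \<in> topspace X. \<pi> x \<in> \<Union> K}"
      unfolding eq by (rule openin_Union) (use K in blast)
    show "\<Union> K \<subseteq> \<pi> ` topspace X" using K by blast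
  qed
  then show ?thesis unfolding quotient_top_def by (simp only: topology_inverse')
qed

lemma topspace_quotient_top: "topspace (quotient_top X \<pi>) = \<pi> ` topspace X"
proof -
  have "{x \<in> topspace X. \<pi> x \<in> \<pi> ` topspace X} = topspace X" by blast
  then have "openin (quotient_top X \<pi>) (\<pi> ` topspace X)"
    unfolding openin_quotient_top by (simp only: openin_topspace subset_refl)
  moreover have "topspace (quotient_top X \<pi>) \<subseteq> \<pi> ` topspace X"
    using openin_topspace[of "quotient_top X \<pi>"] unfolding openin_quotient_top by (rule conjunct1)
  ultimately show ?thesis by (intro subset_antisym openin_subset)
qed

lemma quotient_map_quotient_top: "quotient_map X (quotient_top X \<pi>) \<pi>"
  unfolding quotient_map_def topspace_quotient_top openin_quotient_top by blast

definition coset_top :: "('g, 'm) monoid_scheme \<Rightarrow> 'g topology \<Rightarrow> 'g set \<Rightarrow> 'g set topology" where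
  "coset_top G X T = quotient_top X (r_coset G T)"


section \<open>Representations\<close>

definition is_rep ::
  "('g, 'm) monoid_scheme \<Rightarrow> 'g topology \<Rightarrow> nat \<Rightarrow> ('g \<Rightarrow> complex mat) \<Rightarrow> bool" where
  "is_rep G X m \<rho> \<longleftrightarrow>
     (\<forall>g\<in>carrier G. \<rho> g \<in> carrier_mat m m) \<and>
     \<rho> \<one>\<^bsub>G\<^esub> = 1\<^sub>m m \<and>
     (\<forall>g\<in>carrier G. \<forall>h\<in>carrier G. \<rho> (g \<otimes>\<^bsub>G\<^esub> h) = \<rho> g * \<rho> h) \<and>
     (\<forall>i<m. \<forall>j<m. continuous_map X euclidean (\<lambda>g. \<rho> g $$ (i, j)))"

text \<open>Isomorphism of the restrictions of two representations to the subgroup \<open>S\<close>.\<close>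

definition rep_iso_on :: "'g set \<Rightarrow> ('g \<Rightarrow> complex mat) \<Rightarrow> ('g \<Rightarrow> complex mat) \<Rightarrow> bool" where
  "rep_iso_on S \<rho> \<sigma> \<longleftrightarrow> (\<exists>P Q. \<forall>g\<in>S. similar_mat_wit (\<rho> g) (\<sigma> g) P Q)"

definition rep_char :: "('g \<Rightarrow> complex mat) \<Rightarrow> 'g \<Rightarrow> complex" where
  "rep_char \<rho> g = (\<Sum>i<dim_row (\<rho> g). \<rho> g $$ (i, i))"

definition dual_rep :: "('g, 'm) monoid_scheme \<Rightarrow> ('g \<Rightarrow> complex mat) \<Rightarrow> 'g \<Rightarrow> complex mat" where
  "dual_rep G \<rho> g = transpose_mat (\<rho> (inv\<^bsub>G\<^esub> g))"

definition direct_sum_rep :: "('g \<Rightarrow> complex mat) list \<Rightarrow> 'g \<Rightarrow> complex mat" where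
  "direct_sum_rep \<rho>s g = diag_block_mat (map (\<lambda>\<rho>. \<rho> g) \<rho>s)"


section \<open>Graphs with a torus action\<close>

text \<open>
  The arcs are the oriented edges, \<open>rv\<close> reverses the orientation (a fixed-point-free involution on
  the arcs), \<^const>\<open>tail\<close> is the initial and \<^const>\<open>head\<close> the terminal vertex. Multiple edges are
  allowed.
\<close>

definition valent_graph :: "nat \<Rightarrow> ('v, 'e) pre_digraph \<Rightarrow> ('e \<Rightarrow> 'e) \<Rightarrow> bool" where
  "valent_graph d \<Gamma> rv \<longleftrightarrow>
     fin_digraph \<Gamma> \<and> bidirected_digraph \<Gamma> rv \<and> (\<forall>p\<in>verts \<Gamma>. out_degree \<Gamma> p = d)"

definition edge_group ::
  "('g, 'm) monoid_scheme \<Rightarrow> ('a::real_normed_vector \<Rightarrow> 'g) \<Rightarrow> ('e \<Rightarrow> ('a \<Rightarrow>\<^sub>L real)) \<Rightarrow> 'e \<Rightarrow> 'g set"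
  where
  "edge_group G ex \<alpha> e = kernel G circle_group (weight_char ex (\<alpha> e))"

text \<open>
  In the second clause the list merely fixes an order of the summands; up to isomorphism the direct
  sum does not depend on it.
\<close>

definition graph_action ::
  "('g, 'm) monoid_scheme \<Rightarrow> 'g topology \<Rightarrow> ('a::real_normed_vector \<Rightarrow> 'g) \<Rightarrow>
   nat \<Rightarrow> ('v, 'e) pre_digraph \<Rightarrow> ('e \<Rightarrow> 'e) \<Rightarrow>
   ('e \<Rightarrow> 'g \<Rightarrow> complex mat) \<Rightarrow> ('e \<Rightarrow> ('a \<Rightarrow>\<^sub>L real)) \<Rightarrow> ('v \<Rightarrow> 'g \<Rightarrow> complex mat) \<Rightarrow> bool" where
  "graph_action G X ex d \<Gamma> rv \<rho> \<alpha> \<tau> \<longleftrightarrow>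
     (\<forall>e\<in>arcs \<Gamma>. is_rep G X 1 (\<rho> e) \<and> \<alpha> e \<in> weight_lattice G ex \<and>
        (\<forall>g\<in>carrier G. rep_char (\<rho> e) g = weight_char ex (\<alpha> e) g)) \<and>
     (\<forall>p\<in>verts \<Gamma>. is_rep G X d (\<tau> p) \<and>
        (\<exists>es. distinct es \<and> set es = out_arcs \<Gamma> p \<and>
           rep_iso_on (carrier G) (\<tau> p) (direct_sum_rep (map \<rho> es)))) \<and>
     (\<forall>e\<in>arcs \<Gamma>. rep_iso_on (carrier G) (\<rho> (rv e)) (dual_rep G (\<rho> e))) \<and>
     (\<forall>e\<in>arcs \<Gamma>. rep_iso_on (edge_group G ex \<alpha> e) (\<tau> (tail \<Gamma> e)) (\<tau> (head \<Gamma> e)))"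

text \<open>Distinctness of the two weights is required separately because \<open>{\<beta>, \<beta>}\<close> is a singleton set.\<close>

definition gkm :: "('v, 'e) pre_digraph \<Rightarrow> ('e \<Rightarrow> ('a::real_normed_vector \<Rightarrow>\<^sub>L real)) \<Rightarrow> bool" where
  "gkm \<Gamma> \<alpha> \<longleftrightarrow>
     (\<forall>e1\<in>arcs \<Gamma>. \<forall>e2\<in>arcs \<Gamma>. e1 \<noteq> e2 \<and> tail \<Gamma> e1 = tail \<Gamma> e2 \<longrightarrow>
        \<alpha> e1 \<noteq> \<alpha> e2 \<and> independent {\<alpha> e1, \<alpha> e2})"

definition K_ring ::
  "('g, 'm) monoid_scheme \<Rightarrow> 'g topology \<Rightarrow> ('a::real_normed_vector \<Rightarrow> 'g) \<Rightarrow>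
   ('v, 'e) pre_digraph \<Rightarrow> ('e \<Rightarrow> ('a \<Rightarrow>\<^sub>L real)) \<Rightarrow> ('v \<Rightarrow> 'g \<Rightarrow> complex) set" where
  "K_ring G X ex \<Gamma> \<alpha> =
     {f \<in> verts \<Gamma> \<rightarrow> rep_ring G X. \<forall>e\<in>arcs \<Gamma>.
        restrict (f (tail \<Gamma> e)) (edge_group G ex \<alpha> e) =
        restrict (f (head \<Gamma> e)) (edge_group G ex \<alpha> e)}"

definition moment_map ::
  "('v, 'e) pre_digraph \<Rightarrow> ('e \<Rightarrow> ('a::real_normed_vector \<Rightarrow>\<^sub>L real)) \<Rightarrow> 'a \<Rightarrow> ('v \<Rightarrow> real) \<Rightarrow> bool" where
  "moment_map \<Gamma> \<alpha> \<xi> \<phi> \<longleftrightarrow>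
     (\<forall>e\<in>arcs \<Gamma>. (\<phi> (head \<Gamma> e) - \<phi> (tail \<Gamma> e)) / blinfun_apply (\<alpha> e) \<xi> > 0)"

definition regular_value :: "('v, 'e) pre_digraph \<Rightarrow> ('v \<Rightarrow> real) \<Rightarrow> real \<Rightarrow> bool" where
  "regular_value \<Gamma> \<phi> c \<longleftrightarrow> c \<notin> \<phi> ` verts \<Gamma>"

definition cross_section :: "('v, 'e) pre_digraph \<Rightarrow> ('v \<Rightarrow> real) \<Rightarrow> real \<Rightarrow> 'e set" where
  "cross_section \<Gamma> \<phi> c = {e \<in> arcs \<Gamma>. \<phi> (head \<Gamma> e) > c \<and> c > \<phi> (tail \<Gamma> e)}"


section \<open>The reduced characters\<close>

definition f_hat ::
  "('a::real_normed_vector \<Rightarrow> 'g) \<Rightarrow> ('v, 'e) pre_digraph \<Rightarrow> ('e \<Rightarrow> ('a \<Rightarrow>\<^sub>L real)) \<Rightarrow>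
   ('v \<Rightarrow> 'g \<Rightarrow> complex) \<Rightarrow> 'e \<Rightarrow> 'g \<Rightarrow> complex" where
  "f_hat ex \<Gamma> \<alpha> f e g =
     f (tail \<Gamma> e) g *
     (\<Prod>e'\<in>out_arcs \<Gamma> (tail \<Gamma> e) - {e}. inverse (1 - weight_char ex (\<alpha> e') g))"

text \<open>
  Push-forward of a function \<open>h\<close> on a subgroup \<open>K\<close> along \<open>K \<rightarrow> G/T\<close>, evaluated at a coset \<open>C\<close>:
  the average of \<open>h\<close> over \<open>g W\<close>, where \<open>W = K \<inter> T\<close> and \<open>g \<in> K\<close> is any element over \<open>C\<close>.
\<close>

definition push_forward ::
  "('g, 'm) monoid_scheme \<Rightarrow> 'g set \<Rightarrow> 'g set \<Rightarrow> ('g \<Rightarrow> complex) \<Rightarrow> 'g set \<Rightarrow> complex" where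
  "push_forward G T K h C =
     (let g = (SOME g. g \<in> K \<and> T #>\<^bsub>G\<^esub> g = C) in
      (\<Sum>w\<in>K \<inter> T. h (g \<otimes>\<^bsub>G\<^esub> w)) / of_nat (card (K \<inter> T)))"

definition f_sharp ::
  "('g, 'm) monoid_scheme \<Rightarrow> ('a::real_normed_vector \<Rightarrow> 'g) \<Rightarrow> 'g set \<Rightarrow> ('v, 'e) pre_digraph \<Rightarrow>
   ('e \<Rightarrow> ('a \<Rightarrow>\<^sub>L real)) \<Rightarrow> ('v \<Rightarrow> 'g \<Rightarrow> complex) \<Rightarrow> 'e \<Rightarrow> 'g set \<Rightarrow> complex" where
  "f_sharp G ex T \<Gamma> \<alpha> f e =
     push_forward G T (edge_group G ex \<alpha> e) (restrict (f_hat ex \<Gamma> \<alpha> f e) (edge_group G ex \<alpha> e))"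

text \<open>The points of \<open>G/T\<close> over which no denominator of \<^const>\<open>f_hat\<close> vanishes on the edge group.\<close>

definition sharp_domain ::
  "('g, 'm) monoid_scheme \<Rightarrow> ('a::real_normed_vector \<Rightarrow> 'g) \<Rightarrow> 'g set \<Rightarrow> ('v, 'e) pre_digraph \<Rightarrow>
   ('e \<Rightarrow> ('a \<Rightarrow>\<^sub>L real)) \<Rightarrow> 'e \<Rightarrow> 'g set set" where
  "sharp_domain G ex T \<Gamma> \<alpha> e =
     {C \<in> carrier (G Mod T).
        \<forall>g\<in>edge_group G ex \<alpha> e. T #>\<^bsub>G\<^esub> g = C \<longrightarrow>
          (\<forall>e'\<in>out_arcs \<Gamma> (tail \<Gamma> e) - {e}. weight_char ex (\<alpha> e') g \<noteq> 1)}"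

definition chi_domain ::
  "('g, 'm) monoid_scheme \<Rightarrow> ('a::real_normed_vector \<Rightarrow> 'g) \<Rightarrow> 'g set \<Rightarrow> ('v, 'e) pre_digraph \<Rightarrow>
   ('e \<Rightarrow> ('a \<Rightarrow>\<^sub>L real)) \<Rightarrow> ('v \<Rightarrow> real) \<Rightarrow> real \<Rightarrow> 'g set set" where
  "chi_domain G ex T \<Gamma> \<alpha> \<phi> c =
     {C \<in> carrier (G Mod T). \<forall>e\<in>cross_section \<Gamma> \<phi> c. C \<in> sharp_domain G ex T \<Gamma> \<alpha> e}"

definition chi_c ::
  "('g, 'm) monoid_scheme \<Rightarrow> ('a::real_normed_vector \<Rightarrow> 'g) \<Rightarrow> 'g set \<Rightarrow> ('v, 'e) pre_digraph \<Rightarrow>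
   ('e \<Rightarrow> ('a \<Rightarrow>\<^sub>L real)) \<Rightarrow> ('v \<Rightarrow> real) \<Rightarrow> real \<Rightarrow> ('v \<Rightarrow> 'g \<Rightarrow> complex) \<Rightarrow> 'g set \<Rightarrow> complex" where
  "chi_c G ex T \<Gamma> \<alpha> \<phi> c f C = (\<Sum>e\<in>cross_section \<Gamma> \<phi> c. f_sharp G ex T \<Gamma> \<alpha> f e C)"

text \<open>
  A function \<open>F\<close>, meaningful only on \<open>D\<close>, is defined generically and given by an element of \<open>R\<close>.
  Openness and density of \<open>D\<close> are part of the notion, so that it is not vacuous and determines the
  element among the continuous functions.
\<close>

definition generically_in :: "'h topology \<Rightarrow> 'h set \<Rightarrow> ('h \<Rightarrow> complex) \<Rightarrow> ('h \<Rightarrow> complex) set \<Rightarrow> bool" where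
  "generically_in Y D F R \<longleftrightarrow>
     openin Y D \<and> Y closure_of D = topspace Y \<and> (\<exists>h\<in>R. \<forall>x\<in>D. F x = h x)"

end

theory Submission
  imports Defs "Jordan_Normal_Form.Char_Poly"
begin

text \<open>
  Attach to a vertex \<open>p\<close> the sum of \<open>\<plusminus> f_sharp e\<close> over the edges \<open>e\<close> issuing from \<open>p\<close>, with the sign of
  \<open>\<alpha>\<^sub>e(\<xi>)\<close>. Because \<open>f\<close> and the isotropy representations of the two ends of \<open>e\<close> agree on \<open>G\<^sub>e\<close>,
  \<open>f_sharp e\<close> does not change when \<open>e\<close> is reversed, while the sign does; so \<open>\<chi>\<^sub>c(f)\<close> is the sum of these
  vertex terms over all \<open>p\<close> with \<open>\<phi>(p) < c\<close>. On the coset of \<open>g\<close>, the vertex term is minus the sum of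
  the residues in \<open>z \<noteq> 0\<close> of \<open>f\<^sub>p(gz) / \<Prod>(1 - e\<^bsup>2\<pi>i\<alpha>\<^sub>e\<^esup>(gz)) dz/z\<close>, where \<open>z\<close> runs through the
  complexified circle. Hence it is a difference of constant terms of expansions at \<open>0\<close> and \<open>\<infinity>\<close>, whose
  coefficients are integral combinations of characters trivial on \<open>T\<close>. This integrality is obtained
  from a recursion in the exponent of \<open>z\<close> together with the vanishing of \<open>\<Sum> q(r)/P'(r)\<close> over the roots
  \<open>r\<close> of \<open>P\<close> when \<open>deg q < deg P - 1\<close>. All this needs the poles at every vertex to be simple, which
  holds on a dense subset of the domain only; the identity extends by continuity.
\<close>

section \<open>Sums over roots\<close>

text \<open>Lagrange interpolation at the simple roots reproduces \<open>q\<close>, whose degree is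
  below \<open>card A\<close>. The sum times \<open>lead_coeff P\<close> is the coefficient of the
  interpolant at \<open>degree P - 1\<close>, and there \<open>q\<close> has coefficient zero. In
  terms of residues: \<open>q / P\<close> has none at infinity.\<close>

lemma sum_divide_pderiv_roots:
  fixes P q :: "complex poly"
  assumes "finite A" and card: "card A = degree P"
    and root: "\<And>r. r \<in> A \<Longrightarrow> poly P r = 0" and simple: "\<And>r. r \<in> A \<Longrightarrow> poly (pderiv P) r \<noteq> 0"
    and deg: "degree q + 1 < degree P"
  shows "(\<Sum>r\<in>A. poly q r / poly (pderiv P) r) = 0"
proof -
  from deg have P0: "P \<noteq> 0" by auto
  have "\<forall>r\<in>A. \<exists>Q. P = [:-r, 1:] * Q"
    using root by (simp add: poly_eq_0_iff_dvd dvd_def)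
  from bchoice[OF this] obtain Q where Q: "\<And>r. r \<in> A \<Longrightarrow> P = [:-r, 1:] * Q r" by blast
  have Q0: "Q r \<noteq> 0" if "r \<in> A" for r using Q[OF that] P0 by auto
  have degQ: "degree P = Suc (degree (Q r))" if "r \<in> A" for r
  proof -
    have "degree P = degree ([:-r, 1:] * Q r)" by (rule arg_cong[OF Q[OF that]])
    also have "\<dots> = Suc (degree (Q r))"
      using Q0[OF that] by (subst degree_mult_eq) auto
    finally show ?thesis .
  qed
  have leadQ: "lead_coeff (Q r) = lead_coeff P" if "r \<in> A" for r
  proof -
    have "lead_coeff P = lead_coeff ([:-r, 1:] * Q r)" by (rule arg_cong[OF Q[OF that]])
    also have "\<dots> = lead_coeff (Q r)" by (subst lead_coeff_mult) simp
    finally show ?thesis ..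
  qed
  have Qr: "poly (Q r) r = poly (pderiv P) r" if "r \<in> A" for r
  proof -
    have "pderiv P = pderiv ([:-r, 1:] * Q r)" by (rule arg_cong[OF Q[OF that]])
    also have "\<dots> = [:-r, 1:] * pderiv (Q r) + Q r"
      by (subst pderiv_mult) (simp add: pderiv_pCons)
    finally show ?thesis by simp
  qed
  have Qs: "poly (Q r) s = 0" if "r \<in> A" "s \<in> A" "s \<noteq> r" for r s
  proof -
    have "poly P s = poly ([:-r, 1:] * Q r) s" by (rule arg_cong[OF Q[OF that(1)]])
    also have "\<dots> = (s - r) * poly (Q r) s" by (simp add: algebra_simps)
    finally show ?thesis using root[OF that(2)] that(3) by simp
  qed
  \<comment> \<open>The Lagrange interpolant: \<open>Q r\<close> divided by its value
    \<open>poly (pderiv P) r\<close> is 1 at \<open>r\<close> and 0 at the other elements of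
    \<open>A\<close>.\<close>
  define L where "L = (\<Sum>r\<in>A. Polynomial.smult (poly q r / poly (pderiv P) r) (Q r))"
  have Ls: "poly L s = poly q s" if "s \<in> A" for s
  proof -
    have "poly L s = (\<Sum>r\<in>A. if r = s then poly q s else 0)"
      unfolding L_def poly_sum
      by (rule sum.cong) (use that simple Qr Qs in auto)
    then show ?thesis using that \<open>finite A\<close> by simp
  qed
  have "degree L \<le> degree P - 1"
    unfolding L_def
    by (intro degree_sum_le \<open>finite A\<close> order.trans[OF degree_smult_le]) (simp add: degQ)
  then have "degree (L - q) \<le> degree P - 1"
    using deg by (intro degree_diff_le) auto
  then have dLq: "degree (L - q) < card A" using deg card by simp
  have "L - q = 0"
  proof (rule ccontr)
    assume "L - q \<noteq> 0"
    then have "card {x. poly (L - q) x = 0} \<le> degree (L - q)"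
      and "finite {x. poly (L - q) x = 0}"
      by (blast intro: poly_roots_degree poly_roots_finite)+
    moreover have "A \<subseteq> {x. poly (L - q) x = 0}" using Ls by auto
    ultimately have "card A \<le> degree (L - q)" by (meson card_mono le_trans)
    with dLq show False by simp
  qed
  then have "coeff L (degree P - 1) = coeff q (degree P - 1)" by simp
  also have "\<dots> = 0" using deg by (intro coeff_eq_0) auto
  finally have "0 = coeff L (degree P - 1)" by simp
  also have "\<dots> = (\<Sum>r\<in>A. (poly q r / poly (pderiv P) r) * lead_coeff P)"
    unfolding L_def coeff_sum coeff_smult
    by (rule sum.cong) (use leadQ degQ in \<open>auto\<close>)
  finally have "(\<Sum>r\<in>A. poly q r / poly (pderiv P) r) * lead_coeff P = 0"
    by (simp add: sum_distrib_right)
  then show ?thesis using P0 by simp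
qed

section \<open>Residue sums over the roots of \<open>b * z powi m = 1\<close>\<close>

text \<open>The poles of \<open>inverse (1 - b * z powi m)\<close> in z \<noteq> 0. With
  \<open>b = \<eta> e g\<close> and \<open>m = m e\<close> they will parametrise the points of the
  edge group over the coset of \<open>g\<close>.\<close>

definition root_set :: "complex \<Rightarrow> int \<Rightarrow> complex set" where
  "root_set b m = {z. z \<noteq> 0 \<and> b * z powi m = 1}"

text \<open>Reduces negative exponents to positive ones.\<close>

lemma root_set_uminus: "root_set (inverse b) (- m) = root_set b m"
  by (auto simp: root_set_def power_int_minus field_simps)

lemma root_set_eq:
  assumes "b \<noteq> 0" "m > 0"
  shows "root_set b m = {z. z ^ nat m = inverse b}"
  using assms by (auto simp: root_set_def power_int_def field_simps power_0_left)

lemma card_root_set: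
  assumes "b \<noteq> 0" "m \<noteq> 0"
  shows "card (root_set b m) = nat \<bar>m\<bar>" "finite (root_set b m)"
proof -
  have *: "card (root_set b m) = nat \<bar>m\<bar> \<and> finite (root_set b m)"
    if "b \<noteq> 0" "m > 0" for b m
    using that by (simp add: root_set_eq card_nth_roots finite_nth_roots)
  have "card (root_set b m) = nat \<bar>m\<bar> \<and> finite (root_set b m)"
    using *[of b m] *[of "inverse b" "-m"] assms root_set_uminus[of b m]
    by (cases "m > 0") auto
  then show "card (root_set b m) = nat \<bar>m\<bar>" "finite (root_set b m)" by auto
qed

text \<open>
  Up to sign, the sum of the residues of \<open>z powi k / (\<Prod>i\<in>I. 1 - b i * z powi m i) * dz/z\<close> over the
  nonzero complex numbers, provided that all poles are simple.
\<close>

definition root_sum :: "'i set \<Rightarrow> ('i \<Rightarrow> complex) \<Rightarrow> ('i \<Rightarrow> int) \<Rightarrow> int \<Rightarrow> complex" where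
  "root_sum I b m k =
     (\<Sum>i\<in>I. (\<Sum>z\<in>root_set (b i) (m i).
        z powi k * (\<Prod>j\<in>I - {i}. inverse (1 - b j * z powi m j))) / of_int (m i))"

text \<open>Poles of different factors do not collide. The roots of a single factor are simple when
  \<open>b\<close> and \<open>m\<close> are nonzero, so all poles of the integrand behind
  \<open>root_sum\<close> are then simple.\<close>

definition generic_roots :: "'i set \<Rightarrow> ('i \<Rightarrow> complex) \<Rightarrow> ('i \<Rightarrow> int) \<Rightarrow> bool" where
  "generic_roots I b m \<longleftrightarrow>
     (\<forall>i\<in>I. \<forall>j\<in>I. i \<noteq> j \<longrightarrow> root_set (b i) (m i) \<inter> root_set (b j) (m j) = {})"

lemma generic_roots_subset: "generic_roots I b m \<Longrightarrow> J \<subseteq> I \<Longrightarrow> generic_roots J b m"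
  by (auto simp: generic_roots_def)

lemma root_set_norm:
  assumes "z \<in> root_set b m" "norm b = 1" "m \<noteq> 0"
  shows "norm z = 1"
proof -
  have *: "norm z = 1" if "z \<in> root_set b m" "norm b = 1" "m > 0" for b m
  proof -
    have "norm (b * z powi m) = 1" using that by (simp add: root_set_def)
    then have "norm z ^ nat m = 1" using that by (simp add: norm_mult power_int_def norm_power)
    then show ?thesis using that power_eq_1_iff[of "norm z" "nat m"] by auto
  qed
  show ?thesis
    using *[of b m] *[of "inverse b" "- m"] assms by (cases "m > 0") (auto simp: root_set_uminus norm_inverse)
qed

lemma root_sum_empty [simp]: "root_sum {} b m k = 0"
  by (simp add: root_sum_def)

text \<open>Multiplying the integrand by \<open>1 - b i * z powi m i\<close> kills the terms at the
  roots of factor \<open>i\<close>; at all other roots it cancels that factor of the denominator and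
  leaves the root sum over the remaining factors.\<close>

lemma root_sum_step:
  assumes "finite I" "i \<in> I" "generic_roots I b m"
  shows "root_sum I b m k = b i * root_sum I b m (k + m i) + root_sum (I - {i}) b m k"
proof -
  let ?P = "\<lambda>J l z. \<Prod>j\<in>J - {l}. inverse (1 - b j * z powi m j)"
  let ?R = "\<lambda>l. root_set (b l) (m l)"
  have "root_sum I b m k - b i * root_sum I b m (k + m i)
     = (\<Sum>l\<in>I. (\<Sum>z\<in>?R l. z powi k * (1 - b i * z powi m i) * ?P I l z) / of_int (m l))"
    unfolding root_sum_def sum_distrib_left sum_subtractf[symmetric] diff_divide_distrib[symmetric]
      sum_divide_distrib
    by (intro sum.cong refl) (auto simp: root_set_def power_int_add algebra_simps diff_divide_distrib)
  also have "\<dots> = (\<Sum>l\<in>I - {i}. (\<Sum>z\<in>?R l. z powi k * (1 - b i * z powi m i) * ?P I l z) / of_int (m l))"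
  proof (rule sum.mono_neutral_right)
    have "(\<Sum>z\<in>?R i. z powi k * (1 - b i * z powi m i) * ?P I i z) = 0"
      by (rule sum.neutral) (auto simp: root_set_def)
    then show "\<forall>l\<in>I - (I - {i}). (\<Sum>z\<in>?R l. z powi k * (1 - b i * z powi m i) * ?P I l z) / of_int (m l) = 0"
      by auto
  qed (use assms in auto)
  also have "\<dots> = root_sum (I - {i}) b m k"
    unfolding root_sum_def
  proof (intro sum.cong refl arg_cong2[where f = "(/)"])
    fix l z assume l: "l \<in> I - {i}" and z: "z \<in> ?R l"
    \<comment> \<open>Genericity keeps the cancelled factor away from zero, where
      \<open>inverse\<close> would return 0.\<close>
    have "z \<notin> ?R i" using assms(2,3) l z unfolding generic_roots_def by blast
    then have ne: "1 - b i * z powi m i \<noteq> 0" using z by (auto simp: root_set_def)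
    have "I - {l} = insert i (I - {i} - {l})" using l assms(2) by auto
    then have "?P I l z = inverse (1 - b i * z powi m i) * ?P (I - {i}) l z"
      using assms(1) by (simp add: prod.insert_if)
    then show "z powi k * (1 - b i * z powi m i) * ?P I l z = z powi k * ?P (I - {i}) l z"
      using ne by simp
  qed
  finally show ?thesis by (simp add: algebra_simps)
qed

text \<open>Clears the negative powers of \<open>z\<close> in \<open>1 - b * z powi m\<close>.\<close>

definition factor_poly :: "complex \<Rightarrow> int \<Rightarrow> complex poly" where
  "factor_poly b m =
     Polynomial.monom 1 (nat (- m)) - Polynomial.monom b (nat m)"

lemma poly_factor_poly:
  assumes "z \<noteq> 0"
  shows "poly (factor_poly b m) z = z ^ nat (- m) * (1 - b * z powi m)"
  using assms
  by (cases "m \<ge> 0") (auto simp: factor_poly_def poly_monom power_int_def field_simps)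

text \<open>Only one of the two monomials is nonconstant. For positive \<open>m\<close> its
  derivative is rewritten with \<open>b * z powi m = 1\<close>, so that both signs give the same
  formula.\<close>

lemma poly_pderiv_factor_poly:
  assumes "z \<in> root_set b m" "b \<noteq> 0" "m \<noteq> 0"
  shows "poly (pderiv (factor_poly b m)) z = - of_int m * z ^ nat (- m) / z"
proof (cases "m > 0")
  case True
  then have "b * z ^ nat m = 1" "z \<noteq> 0" using assms by (auto simp: root_set_def power_int_def)
  moreover obtain l where "nat m = Suc l" using True by (cases "nat m") auto
  moreover have "of_int m = (of_nat (nat m) :: complex)" using True by simp
  ultimately show ?thesis using True
    by (simp add: factor_poly_def pderiv_diff pderiv_monom poly_monom field_simps del: of_nat_nat)
next
  case False
  then have "z \<noteq> 0" using assms by (auto simp: root_set_def)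
  moreover obtain l where "nat (-m) = Suc l" using False assms(3) by (cases "nat (-m)") auto
  moreover have "- of_int m = (of_nat (nat (-m)) :: complex)" using False by simp
  ultimately show ?thesis using False
    by (simp add: factor_poly_def pderiv_diff pderiv_monom poly_monom field_simps del: of_nat_nat)
qed

lemma degree_factor_poly:
  assumes "b \<noteq> 0" "m \<noteq> 0"
  shows "degree (factor_poly b m) = nat \<bar>m\<bar>" "factor_poly b m \<noteq> 0"
proof -
  show "degree (factor_poly b m) = nat \<bar>m\<bar>"
  proof (cases "m > 0")
    case True
    then show ?thesis unfolding factor_poly_def
      using assms degree_add_eq_right[of "Polynomial.monom 1 (nat (-m))" "- Polynomial.monom b (nat m)"]
      by (simp add: degree_monom_eq)
  next
    case False
    then show ?thesis unfolding factor_poly_def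
      using assms degree_add_eq_left[of "- Polynomial.monom b (nat m)" "Polynomial.monom 1 (nat (-m))"]
      by (simp add: degree_monom_eq)
  qed
  then show "factor_poly b m \<noteq> 0" using assms(2) by auto
qed

text \<open>The lower bound on \<open>k\<close> excludes a residue at 0 and the upper bound one at
  infinity, so the residues at the nonzero poles alone add up to zero. Once negative powers are
  cleared, this is \<open>sum_divide_pderiv_roots\<close>.\<close>

lemma root_sum_eq_0:
  assumes fin: "finite I" and b: "\<And>i. i \<in> I \<Longrightarrow> b i \<noteq> 0" and m: "\<And>i. i \<in> I \<Longrightarrow> m i \<noteq> 0"
    and gen: "generic_roots I b m"
    and k: "1 - (\<Sum>i\<in>I. max 0 (- m i)) \<le> k" "k \<le> (\<Sum>i\<in>I. \<bar>m i\<bar>) - (\<Sum>i\<in>I. max 0 (- m i)) - 1"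
  shows "root_sum I b m k = 0"
proof -
  \<comment> \<open>The power of \<open>z\<close> used for clearing: away from 0, \<open>P\<close>
    is \<open>z ^ N\<close> times the product of the factors
    \<open>1 - b i * z powi m i\<close>.\<close>
  define N where "N = (\<Sum>i\<in>I. nat (- m i))"
  have N: "int N = (\<Sum>i\<in>I. max 0 (- m i))" unfolding N_def of_nat_sum by (rule sum.cong) auto
  define P where "P = (\<Prod>i\<in>I. factor_poly (b i) (m i))"
  define A where "A = (\<Union>i\<in>I. root_set (b i) (m i))"
  \<comment> \<open>In the exponent, \<open>- 1\<close> comes from dz/z and \<open>N\<close>
    compensates the cleared powers.\<close>
  define q where "q = Polynomial.monom (1::complex) (nat (k - 1 + int N))"
  have finA: "finite A" unfolding A_def using fin b m card_root_set(2) by auto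
  have degP: "degree P = (\<Sum>i\<in>I. nat \<bar>m i\<bar>)"
    unfolding P_def using b m
    by (subst degree_prod_eq_sum_degree) (auto simp: degree_factor_poly)
  have degPi: "int (degree P) = (\<Sum>i\<in>I. \<bar>m i\<bar>)" unfolding degP by simp
  have cardA: "card A = degree P"
    unfolding A_def degP using fin b m gen
    by (subst card_UN_disjoint) (auto simp: card_root_set generic_roots_def)
  have val: "poly P z = 0" if "z \<in> A" for z
  proof -
    from that obtain i where i: "i \<in> I" "z \<in> root_set (b i) (m i)" by (auto simp: A_def)
    then have "poly (factor_poly (b i) (m i)) z = 0"
      by (subst poly_factor_poly) (auto simp: root_set_def)
    with i fin show ?thesis unfolding P_def poly_prod by (auto intro: prod_zero)
  qed
  \<comment> \<open>At a root of factor \<open>i\<close> the product rule leaves only the term that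
    differentiates this factor.\<close>
  have der: "poly (pderiv P) z = - of_int (m i) * z ^ N / z * (\<Prod>j\<in>I - {i}. 1 - b j * z powi m j)"
    if i: "i \<in> I" "z \<in> root_set (b i) (m i)" for i z
  proof -
    have z0: "z \<noteq> 0" using i by (auto simp: root_set_def)
    have Pi: "P = factor_poly (b i) (m i) * (\<Prod>j\<in>I - {i}. factor_poly (b j) (m j))"
      unfolding P_def using fin i by (simp add: prod.remove)
    have "poly (factor_poly (b i) (m i)) z = 0"
      using i by (subst poly_factor_poly) (auto simp: root_set_def)
    then have "poly (pderiv P) z = poly (pderiv (factor_poly (b i) (m i))) z *
        (\<Prod>j\<in>I - {i}. poly (factor_poly (b j) (m j)) z)"
      by (subst Pi) (simp add: pderiv_mult poly_prod)
    also have "(\<Prod>j\<in>I - {i}. poly (factor_poly (b j) (m j)) z)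
      = (\<Prod>j\<in>I - {i}. z ^ nat (- m j)) * (\<Prod>j\<in>I - {i}. 1 - b j * z powi m j)"
      unfolding prod.distrib[symmetric] by (simp add: poly_factor_poly z0)
    also have "(\<Prod>j\<in>I - {i}. z ^ nat (- m j)) = z ^ (\<Sum>j\<in>I - {i}. nat (- m j))"
      by (simp add: power_sum)
    also have "poly (pderiv (factor_poly (b i) (m i))) z = - of_int (m i) * z ^ nat (- m i) / z"
      using i b m by (intro poly_pderiv_factor_poly) auto
    finally have "poly (pderiv P) z = - of_int (m i) * (z ^ nat (- m i) * z ^ (\<Sum>j\<in>I - {i}. nat (- m j))) / z
      * (\<Prod>j\<in>I - {i}. 1 - b j * z powi m j)" by (simp add: mult_ac)
    also have "z ^ nat (- m i) * z ^ (\<Sum>j\<in>I - {i}. nat (- m j)) = z ^ N"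
      unfolding N_def power_add[symmetric] using fin i by (simp add: sum.remove)
    finally show ?thesis .
  qed
  have nz: "(\<Prod>j\<in>I - {i}. 1 - b j * z powi m j) \<noteq> 0"
    if i: "i \<in> I" "z \<in> root_set (b i) (m i)" for i z
  proof -
    have "b j * z powi m j \<noteq> 1" if "j \<in> I - {i}" for j
    proof -
      have "z \<notin> root_set (b j) (m j)" using gen i that unfolding generic_roots_def by blast
      then show ?thesis using i by (auto simp: root_set_def)
    qed
    then show ?thesis using fin by (auto simp: prod_zero_iff)
  qed
  have "root_sum I b m k = - (\<Sum>i\<in>I. \<Sum>z\<in>root_set (b i) (m i). poly q z / poly (pderiv P) z)"
    unfolding root_sum_def sum_negf[symmetric] sum_divide_distrib
  proof (intro sum.cong refl)
    fix i z assume i: "i \<in> I" "z \<in> root_set (b i) (m i)"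
    have z0: "z \<noteq> 0" using i by (auto simp: root_set_def)
    have "z powi (k - 1 + int N) = z powi k / z * z ^ N"
      using z0 by (simp add: power_int_add power_int_diff)
    moreover have "poly q z = z powi (k - 1 + int N)"
      using k N by (simp add: q_def poly_monom power_int_def)
    ultimately show "z powi k * (\<Prod>j\<in>I - {i}. inverse (1 - b j * z powi m j)) / of_int (m i)
       = - (poly q z / poly (pderiv P) z)"
      using z0 nz[OF i] m[OF i(1)]
      unfolding der[OF i] prod_inversef[unfolded o_def] by (simp add: field_simps)
  qed
  also have "(\<Sum>i\<in>I. \<Sum>z\<in>root_set (b i) (m i). poly q z / poly (pderiv P) z)
     = (\<Sum>z\<in>A. poly q z / poly (pderiv P) z)"
    unfolding A_def using fin gen b m
    by (subst sum.UNION_disjoint) (auto simp: card_root_set generic_roots_def)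
  also have "\<dots> = 0"
  proof (rule sum_divide_pderiv_roots[OF finA cardA val])
    fix z assume "z \<in> A"
    then obtain i where i: "i \<in> I" "z \<in> root_set (b i) (m i)" by (auto simp: A_def)
    then have "z \<noteq> 0" by (auto simp: root_set_def)
    then show "poly (pderiv P) z \<noteq> 0" using der[OF i] nz[OF i] m[OF i(1)] by simp
  next
    have "degree q = nat (k - 1 + int N)" unfolding q_def by (simp add: degree_monom_eq)
    then show "degree q + 1 < degree P" using k N degPi by linarith
  qed
  finally show ?thesis by simp
qed

text \<open>For a single factor, the exponents treated by \<open>root_sum_eq_0\<close> meet every
  residue class modulo \<open>m i\<close> except that of 0. There each of the \<bar>m i\<bar> roots
  contributes 1 / m i.\<close>

lemma root_sum_singleton_0:
  assumes "b i \<noteq> 0" "m i \<noteq> 0"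
  shows "root_sum {i} b m 0 = of_int (sgn (m i))"
  using assms card_root_set[of "b i" "m i"]
  by (auto simp: root_sum_def sgn_if abs_if)

section \<open>Characters and the circle subgroup\<close>

lemma cis_2pi_eq_1_iff: "cis (2 * pi * x) = 1 \<longleftrightarrow> x \<in> \<int>"
proof
  assume "cis (2 * pi * x) = 1"
  then have "exp (\<i> * of_real (2 * pi * x)) = 1" by (simp only: cis_conv_exp)
  then obtain k :: int where "2 * pi * x = of_int (2 * k) * pi"
    unfolding exp_eq_1 by auto
  then have "x = of_int k" by simp
  then show "x \<in> \<int>" by simp
next
  assume "x \<in> \<int>"
  then show "cis (2 * pi * x) = 1" by (rule cis_multiple_2pi)
qed

lemma cis_2pi_powi: "cis (2 * pi * x) powi k = cis (2 * pi * (of_int k * x))"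
  by (simp add: cis_power_int mult_ac)

lemma unit_complex_eq_cis:
  assumes "norm z = 1"
  shows "z = cis (2 * pi * (Arg z / (2 * pi)))"
proof -
  have "z \<noteq> 0" using assms by auto
  then have "cis (Arg z) = z" using assms by (simp add: cis_Arg sgn_div_norm)
  then show ?thesis by simp
qed

lemma additive_real_bounded_eq_0:
  fixes d :: "real \<Rightarrow> real"
  assumes "\<And>s t. d (s + t) = d s + d t" "\<And>s. \<bar>d s\<bar> \<le> B"
  shows "d s = 0"
proof (rule ccontr)
  assume "d s \<noteq> 0"
  have mult: "d (of_nat k * s) = of_nat k * d s" for k
  proof (induction k)
    case 0
    show ?case using assms(1)[of 0 0] by simp
  next
    case (Suc k)
    then show ?case using assms(1)[of s "of_nat k * s"] by (simp add: algebra_simps)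
  qed
  obtain k :: nat where "B < of_nat k * \<bar>d s\<bar>"
    using reals_Archimedean3[of "\<bar>d s\<bar>"] \<open>d s \<noteq> 0\<close> by auto
  then show False using assms(2)[of "of_nat k * s"] by (simp add: mult abs_mult)
qed

text \<open>The line is contractible, so \<open>h\<close> has a continuous angle. The angle is
  additive up to full turns, hence additive by connectedness, and a continuous additive function is
  linear.\<close>

lemma continuous_hom_circle_eq_cis:
  fixes h :: "real \<Rightarrow> complex"
  assumes cont: "continuous_on UNIV h" and hom: "\<And>s t. h (s + t) = h s * h t"
    and norm: "\<And>s. norm (h s) = 1"
  obtains a where "\<And>s. h s = cis (a * s)"
proof -
  have "h s \<noteq> 0" for s using norm[of s] by auto
  then obtain g where g: "continuous_on UNIV g" "\<And>s. h s = exp (g s)"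
    using continuous_logarithm_on_contractible[OF cont convex_imp_contractible[OF convex_UNIV]]
    by auto
  have h0: "h 0 = 1" using hom[of 0 0] norm[of 0] by (metis add_0 mult_cancel_left2 norm_zero zero_neq_one)
  \<comment> \<open>Normalises the angle to vanish at 0; \<open>h\<close> is still its
    \<open>cis\<close> because \<open>h 0 = 1\<close>.\<close>
  define \<theta> where "\<theta> s = Im (g s) - Im (g 0)" for s
  have cont\<theta>: "continuous_on UNIV \<theta>" unfolding \<theta>_def by (intro continuous_intros g(1))
  have im: "h s = cis (Im (g s))" for s
  proof -
    have "exp (Re (g s)) = 1" using norm[of s] by (simp add: g(2))
    then show ?thesis by (simp add: g(2) exp_eq_polar)
  qed
  have h: "h s = cis (\<theta> s)" for s
    using im[of s] im[of 0] h0 by (simp add: \<theta>_def cis_divide[symmetric])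
  have add: "\<theta> (s + t) = \<theta> s + \<theta> t" for s t
  proof -
    \<comment> \<open>The number of full turns by which additivity fails. It is integral and
      continuous in \<open>u\<close>, hence constant, and it vanishes at
      \<open>u = 0\<close>.\<close>
    define d where "d u = (\<theta> (u + t) - \<theta> u - \<theta> t) / (2 * pi)" for u
    have "cis (2 * pi * d u) = 1" for u
      using hom[of u t] by (simp add: d_def h cis_divide[symmetric])
    then have dZ: "d u \<in> \<int>" for u by (simp only: cis_2pi_eq_1_iff)
    have contd: "continuous_on UNIV d" unfolding d_def
      by (intro continuous_intros continuous_on_compose2[OF cont\<theta>]) auto
    have "d constant_on UNIV"
    proof (rule continuous_discrete_range_constant[OF connected_UNIV contd])
      fix x :: real
      show "\<exists>e>0. \<forall>y. y \<in> UNIV \<and> d y \<noteq> d x \<longrightarrow> e \<le> norm (d y - d x)"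
        using dZ by (intro exI[of _ 1]) (auto intro!: Ints_nonzero_abs_ge1)
    qed
    then have "d s = d 0" by (auto simp: constant_on_def)
    then show ?thesis by (simp add: d_def \<theta>_def)
  qed
  \<comment> \<open>The deviation from linearity is additive and zero at the integers, so a bound on
    the unit interval holds on the whole line and forces it to vanish.\<close>
  define d where "d s = \<theta> s - s * \<theta> 1" for s
  have dadd: "d (s + t) = d s + d t" for s t by (simp add: d_def add algebra_simps)
  have "d 1 = 0" by (simp add: d_def)
  have d0: "d 0 = 0" using dadd[of 0 0] by simp
  have dnat: "d (of_nat k) = 0" for k
    by (induction k) (use dadd[of 1] \<open>d 1 = 0\<close> d0 in auto)
  have dneg: "d (- s) = - d s" for s using dadd[of s "- s"] d0 by simp
  have dint: "d (of_int k) = 0" for k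
    by (cases k rule: int_cases2) (auto simp: dnat dneg)
  have "compact (d ` {0..1})"
    unfolding d_def
    by (intro compact_continuous_image continuous_intros continuous_on_subset[OF cont\<theta>]) auto
  then obtain B where B: "\<And>x. x \<in> {0..1} \<Longrightarrow> \<bar>d x\<bar> \<le> B"
    by (metis compact_imp_bounded bounded_real image_eqI)
  have dB: "\<bar>d s\<bar> \<le> B" for s
  proof -
    have "d s = d (frac s)" using dadd[of "of_int \<lfloor>s\<rfloor>" "frac s"] dint by (simp add: frac_def)
    then show ?thesis using B[of "frac s"] by (simp add: frac_lt_1 less_imp_le)
  qed
  have "h s = cis (\<theta> 1 * s)" for s
  proof -
    have "d s = 0" by (rule additive_real_bounded_eq_0[of d B]) (fact dadd, fact dB)
    then show ?thesis by (simp only: h) (simp add: d_def mult.commute)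
  qed
  then show ?thesis by (rule that)
qed

section \<open>Characters and closure properties of the character ring\<close>

lemma carrier_circle_group [simp]: "carrier circle_group = sphere 0 1"
  and mult_circle_group [simp]: "x \<otimes>\<^bsub>circle_group\<^esub> y = x * y"
  and one_circle_group [simp]: "\<one>\<^bsub>circle_group\<^esub> = 1"
  by (simp_all add: circle_group_def)

lemma characters_norm: "\<psi> \<in> characters H Y \<Longrightarrow> x \<in> carrier H \<Longrightarrow> norm (\<psi> x) = 1"
  by (auto simp: characters_def hom_def Pi_iff)

lemma characters_mult:
  "\<psi> \<in> characters H Y \<Longrightarrow> x \<in> carrier H \<Longrightarrow> y \<in> carrier H \<Longrightarrow>
    \<psi> (x \<otimes>\<^bsub>H\<^esub> y) = \<psi> x * \<psi> y"
  by (auto simp: characters_def hom_def)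

lemma characters_continuous: "\<psi> \<in> characters H Y \<Longrightarrow> continuous_map Y euclidean \<psi>"
  by (simp add: characters_def)

lemma times_characters:
  assumes "\<psi> \<in> characters H Y" "\<psi>' \<in> characters H Y"
  shows "(\<lambda>x. \<psi> x * \<psi>' x) \<in> characters H Y"
  using assms unfolding characters_def
  by (auto simp: hom_def Pi_iff norm_mult continuous_map_atin intro!: tendsto_mult)

lemma inverse_characters:
  assumes "\<psi> \<in> characters H Y" and Y: "topspace Y = carrier H"
  shows "(\<lambda>x. inverse (\<psi> x)) \<in> characters H Y"
proof -
  have "\<psi> x \<noteq> 0" if "x \<in> topspace Y" for x
    using characters_norm[OF assms(1), of x] that Y by auto
  then have "continuous_map Y euclidean (\<lambda>x. inverse (\<psi> x))"
    using characters_continuous[OF assms(1)] by (auto simp: continuous_map_atin intro!: tendsto_inverse)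
  then show ?thesis
    using assms(1) by (auto simp: characters_def hom_def Pi_iff norm_inverse)
qed

lemma rep_ring_0: "(\<lambda>x\<in>carrier H. 0) \<in> rep_ring H Y"
  unfolding rep_ring_def
  by (rule CollectI, rule exI[of _ 0]) auto

lemma rep_ring_character: "\<psi> \<in> characters H Y \<Longrightarrow> (\<lambda>x\<in>carrier H. \<psi> x) \<in> rep_ring H Y"
  unfolding rep_ring_def
  by (rule CollectI, rule exI[of _ 1], rule exI[of _ "\<lambda>_. 1"], rule exI[of _ "\<lambda>_. \<psi>"]) auto

lemma rep_ring_int_mult:
  assumes "a \<in> rep_ring H Y"
  shows "(\<lambda>x\<in>carrier H. of_int c * a x) \<in> rep_ring H Y"
proof -
  obtain N m \<psi> where a: "a = (\<lambda>x\<in>carrier H. \<Sum>k<(N::nat). of_int (m k) * \<psi> k x)"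
    and \<psi>: "\<forall>k<N. \<psi> k \<in> characters H Y"
    using assms unfolding rep_ring_def by blast
  have "(\<lambda>x\<in>carrier H. of_int c * a x) = (\<lambda>x\<in>carrier H. \<Sum>k<N. of_int (c * m k) * \<psi> k x)"
    by (rule restrict_ext) (simp add: a sum_distrib_left mult_ac)
  then show ?thesis unfolding rep_ring_def using \<psi>
    by (intro CollectI exI[of _ N] exI[of _ "\<lambda>k. c * m k"] exI[of _ \<psi>]) simp
qed

lemma rep_ring_add:
  assumes "a \<in> rep_ring H Y" "b \<in> rep_ring H Y"
  shows "(\<lambda>x\<in>carrier H. a x + b x) \<in> rep_ring H Y"
proof -
  obtain N m \<psi> where a: "a = (\<lambda>x\<in>carrier H. \<Sum>k<(N::nat). of_int (m k) * \<psi> k x)"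
    and \<psi>: "\<forall>k<N. \<psi> k \<in> characters H Y"
    using assms(1) unfolding rep_ring_def by blast
  obtain N' m' \<psi>' where b: "b = (\<lambda>x\<in>carrier H. \<Sum>k<(N'::nat). of_int (m' k) * \<psi>' k x)"
    and \<psi>': "\<forall>k<N'. \<psi>' k \<in> characters H Y"
    using assms(2) unfolding rep_ring_def by blast
  let ?m = "\<lambda>k. if k < N then m k else m' (k - N)" and ?\<psi> = "\<lambda>k. if k < N then \<psi> k else \<psi>' (k - N)"
  have "(\<Sum>k<N + N'. of_int (?m k) * ?\<psi> k x)
      = (\<Sum>k<N. of_int (m k) * \<psi> k x) + (\<Sum>k<N'. of_int (m' k) * \<psi>' k x)" for x
  proof -
    have "(\<Sum>k<N + N'. of_int (?m k) * ?\<psi> k x)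
      = (\<Sum>k<N. of_int (?m k) * ?\<psi> k x) + (\<Sum>k=N..<N+N'. of_int (?m k) * ?\<psi> k x)"
      by (subst sum.union_disjoint[symmetric]) (auto intro!: sum.cong)
    also have "(\<Sum>k=N..<N+N'. of_int (?m k) * ?\<psi> k x) = (\<Sum>k<N'. of_int (m' k) * \<psi>' k x)"
      using sum.shift_bounds_nat_ivl[of "\<lambda>k. of_int (?m k) * ?\<psi> k x" 0 N N']
      by (simp add: add.commute atLeast0LessThan)
    finally show ?thesis by simp
  qed
  then have "(\<lambda>x\<in>carrier H. a x + b x) = (\<lambda>x\<in>carrier H. \<Sum>k<N + N'. of_int (?m k) * ?\<psi> k x)"
    by (intro restrict_ext) (simp add: a b)
  moreover have "\<forall>k<N + N'. ?\<psi> k \<in> characters H Y" using \<psi> \<psi>' by auto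
  ultimately show ?thesis unfolding rep_ring_def
    by (intro CollectI exI[of _ "N + N'"] exI[of _ ?m] exI[of _ ?\<psi>]) simp
qed

lemma rep_ring_sum:
  assumes "finite A" "\<And>i. i \<in> A \<Longrightarrow> a i \<in> rep_ring H Y"
  shows "(\<lambda>x\<in>carrier H. \<Sum>i\<in>A. a i x) \<in> rep_ring H Y"
  using assms
proof (induction A rule: finite_induct)
  case empty
  show ?case using rep_ring_0[of H Y] by (simp only: sum.empty)
next
  case (insert i A)
  have "(\<lambda>x\<in>carrier H. \<Sum>j\<in>insert i A. a j x)
      = (\<lambda>x\<in>carrier H. a i x + (\<lambda>x\<in>carrier H. \<Sum>j\<in>A. a j x) x)"
    using insert.hyps by (intro restrict_ext) simp
  also have "\<dots> \<in> rep_ring H Y" using insert by (intro rep_ring_add) auto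
  finally show ?case .
qed

lemma rep_ring_continuous:
  assumes "h \<in> rep_ring H Y" "topspace Y = carrier H"
  shows "continuous_map Y euclidean h"
proof -
  obtain N m \<psi> where h: "h = (\<lambda>x\<in>carrier H. \<Sum>k<(N::nat). of_int (m k) * \<psi> k x)"
    and \<psi>: "\<forall>k<N. \<psi> k \<in> characters H Y"
    using assms(1) unfolding rep_ring_def by blast
  have "continuous_map Y euclidean (\<lambda>x. \<Sum>k<N. of_int (m k) * \<psi> k x)"
    using characters_continuous[of "\<psi> _" H Y] \<psi>
    by (auto simp: continuous_map_atin intro!: tendsto_sum tendsto_mult)
  then show ?thesis
    by (rule continuous_map_eq) (simp add: h assms(2))
qed

section \<open>The circle subgroup as a one-parameter subgroup\<close>

locale circle_in_torus =
  fixes n :: nat and G :: "'g monoid" (structure) and X :: "'g topology"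
    and ex :: "'a::euclidean_space \<Rightarrow> 'g" and T :: "'g set" and \<xi> :: 'a
  assumes torus: "torus n G X ex"
    and circle: "circle_subgroup G X T"
    and generator: "infinitesimal_generator G ex T \<xi>"
begin

sublocale comm_group G
  using torus by (simp add: torus_def)

lemma topspace_X: "topspace X = carrier G"
  and ex_add: "ex (x + y) = ex x \<otimes> ex y"
  and quotient_ex: "quotient_map euclidean X ex"
  using torus by (simp_all add: torus_def)

lemma carrier_eq: "carrier G = range ex"
  using quotient_ex topspace_X by (simp add: quotient_map_def)

lemma ex_closed [simp]: "ex x \<in> carrier G"
  by (simp add: carrier_eq)

lemma ex_0 [simp]: "ex 0 = \<one>"
  using ex_add[of 0 0] l_cancel_one[of "ex 0" "ex 0"] by simp

lemma ex_uminus: "ex (- x) = inv (ex x)"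
  using ex_add[of "- x" x] by (simp add: inv_equality)

lemma continuous_ex: "continuous_map euclidean X ex"
  using quotient_ex by (rule quotient_imp_continuous_map)

lemma continuous_character_path:
  assumes "continuous_map X euclidean \<psi>" "continuous_on UNIV p"
  shows "continuous_on UNIV (\<lambda>s::'b::topological_space. \<psi> (ex (p s)))"
proof -
  have "continuous_map euclidean euclidean (\<psi> \<circ> ex)"
    using continuous_map_compose[OF continuous_ex assms(1)] .
  then have "continuous_on UNIV (\<lambda>x. \<psi> (ex x))" by (simp add: o_def)
  from continuous_on_compose2[OF this assms(2)] show ?thesis by simp
qed

lemma subgroup_T: "subgroup T G"
  using circle by (simp add: circle_subgroup_def)

lemma T_subset: "T \<subseteq> carrier G"
  using subgroup_T by (rule subgroup.subset)

sublocale normal T G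
  using subgroup_T by (rule subgroup_imp_normal)

lemma ex_xi_in_T: "ex (s *\<^sub>R \<xi>) \<in> T" and xi_in_kernel: "ex \<xi> = \<one>"
proof -
  have "\<xi> = real_of_int 1 *\<^sub>R \<xi>" by simp
  then have "\<xi> \<in> range (\<lambda>k::int. real_of_int k *\<^sub>R \<xi>)" by (rule range_eqI)
  then have "\<xi> \<in> lie_subalgebra ex T \<inter> exp_kernel G ex"
    using generator unfolding infinitesimal_generator_def by simp
  then show "ex (s *\<^sub>R \<xi>) \<in> T" "ex \<xi> = \<one>" by (auto simp: lie_subalgebra_def exp_kernel_def)
qed

lemma ex_xi_eq_one_iff: "ex (s *\<^sub>R \<xi>) = \<one> \<longleftrightarrow> s \<in> \<int>"
proof -
  have ker: "lie_subalgebra ex T \<inter> exp_kernel G ex = range (\<lambda>k::int. real_of_int k *\<^sub>R \<xi>)"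
    and "\<xi> \<noteq> 0"
    using generator unfolding infinitesimal_generator_def by auto
  have "s *\<^sub>R \<xi> \<in> lie_subalgebra ex T" by (simp add: lie_subalgebra_def ex_xi_in_T)
  then have "ex (s *\<^sub>R \<xi>) = \<one> \<longleftrightarrow> s *\<^sub>R \<xi> \<in> lie_subalgebra ex T \<inter> exp_kernel G ex"
    by (simp add: exp_kernel_def)
  also have "\<dots> \<longleftrightarrow> s \<in> \<int>" unfolding ker using \<open>\<xi> \<noteq> 0\<close> by (auto simp: Ints_def)
  finally show ?thesis .
qed

text \<open>The isomorphism of \<open>T\<close> with the unit circle turns s \<mapsto> ex (s \<xi>)
  into a continuous homomorphism s \<mapsto> cis (a s). It is onto as soon as a \<noteq> 0.\<close>

lemma T_eq: "T = range (\<lambda>s. ex (s *\<^sub>R \<xi>))"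
proof
  show "range (\<lambda>s. ex (s *\<^sub>R \<xi>)) \<subseteq> T" using ex_xi_in_T by auto
  obtain \<iota> where iso: "\<iota> \<in> iso circle_group (G\<lparr>carrier := T\<rparr>)"
    and homeo: "homeomorphic_map (top_of_set (sphere 0 1)) (subtopology X T) \<iota>"
    using circle unfolding circle_subgroup_def by blast
  obtain j where hm: "homeomorphic_maps (top_of_set (sphere 0 1)) (subtopology X T) \<iota> j"
    using homeo by (auto simp: homeomorphic_map_maps)
  have tops: "topspace (subtopology X T) = T" using T_subset topspace_X by auto
  have contj: "continuous_map (subtopology X T) (top_of_set (sphere 0 1)) j"
    and \<iota>j: "\<And>t. t \<in> T \<Longrightarrow> \<iota> (j t) = t" and j\<iota>: "\<And>z. norm z = 1 \<Longrightarrow> j (\<iota> z) = z"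
    using hm unfolding homeomorphic_maps_def tops by auto
  have jn: "norm (j t) = 1" if "t \<in> T" for t
    using contj that tops by (auto simp: continuous_map_def Pi_iff)
  have \<iota>mult: "\<iota> (z * w) = \<iota> z \<otimes> \<iota> w" if "norm z = 1" "norm w = 1" for z w
    using iso that by (auto simp: iso_def hom_def)
  have jmult: "j (t \<otimes> u) = j t * j u" if "t \<in> T" "u \<in> T" for t u
    using that \<iota>mult[OF jn jn, OF that] j\<iota>[of "j t * j u"] jn by (simp add: \<iota>j norm_mult)
  define h where "h s = j (ex (s *\<^sub>R \<xi>))" for s
  have "continuous_map euclidean X (\<lambda>s. ex (s *\<^sub>R \<xi>))"
    using continuous_map_compose[OF _ continuous_ex, of euclidean "\<lambda>s. s *\<^sub>R \<xi>"]
    by (simp add: o_def continuous_intros)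
  then have "continuous_map euclidean (subtopology X T) (\<lambda>s. ex (s *\<^sub>R \<xi>))"
    using ex_xi_in_T by (auto simp: continuous_map_in_subtopology)
  from continuous_map_compose[OF this contj]
  have conth: "continuous_on UNIV h"
    by (simp add: o_def h_def[abs_def] continuous_map_in_subtopology)
  obtain a where a: "\<And>s. h s = cis (a * s)"
  proof (rule continuous_hom_circle_eq_cis[OF conth])
    show "h (s + t) = h s * h t" for s t
      by (simp add: h_def scaleR_add_left ex_add jmult ex_xi_in_T)
    show "norm (h s) = 1" for s by (simp add: h_def jn ex_xi_in_T)
  qed blast
  \<comment> \<open>Otherwise the path would be constant and 1/2 would be an integer by
    \<open>ex_xi_eq_one_iff\<close>.\<close>
  have "a \<noteq> 0"
  proof
    assume "a = 0"
    then have "h (1/2) = h 0" by (simp add: a)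
    then have "ex ((1/2) *\<^sub>R \<xi>) = ex (0 *\<^sub>R \<xi>)"
      unfolding h_def using \<iota>j ex_xi_in_T by metis
    then have "(1/2 :: real) \<in> \<int>" by (subst ex_xi_eq_one_iff[symmetric]) simp
    then obtain k :: int where "1/2 = real_of_int k" by (auto simp: Ints_def)
    then have "real_of_int (2 * k) = real_of_int 1" by simp
    then have "2 * k = 1" by (simp only: of_int_eq_iff)
    then show False by presburger
  qed
  show "T \<subseteq> range (\<lambda>s. ex (s *\<^sub>R \<xi>))"
  proof
    fix t assume t: "t \<in> T"
    have "j t = cis (Arg (j t))" using unit_complex_eq_cis[OF jn[OF t]] by simp
    then have "j t = h (Arg (j t) / a)" using \<open>a \<noteq> 0\<close> by (simp add: a)
    then have "t = ex ((Arg (j t) / a) *\<^sub>R \<xi>)" unfolding h_def using \<iota>j t ex_xi_in_T by metis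
    then show "t \<in> range (\<lambda>s. ex (s *\<^sub>R \<xi>))" by blast
  qed
qed

text \<open>On the unit circle this is the isomorphism onto \<open>T\<close> with cis (2 pi s)
  \<mapsto> ex (s \<xi>); \<open>Arg\<close> merely selects one logarithm.\<close>

definition circle_elt :: "complex \<Rightarrow> 'g" where
  "circle_elt z = ex ((Arg z / (2 * pi)) *\<^sub>R \<xi>)"

lemma ex_xi_eq_iff: "ex (s *\<^sub>R \<xi>) = ex (t *\<^sub>R \<xi>) \<longleftrightarrow> cis (2 * pi * s) = cis (2 * pi * t)"
proof -
  have "ex (s *\<^sub>R \<xi>) = ex ((s - t) *\<^sub>R \<xi>) \<otimes> ex (t *\<^sub>R \<xi>)"
    by (simp add: ex_add[symmetric] algebra_simps)
  then have "ex (s *\<^sub>R \<xi>) = ex (t *\<^sub>R \<xi>) \<longleftrightarrow> ex ((s - t) *\<^sub>R \<xi>) = \<one>"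
    by simp
  also have "\<dots> \<longleftrightarrow> cis (2 * pi * (s - t)) = 1" by (simp only: ex_xi_eq_one_iff cis_2pi_eq_1_iff)
  also have "cis (2 * pi * (s - t)) = cis (2 * pi * s) / cis (2 * pi * t)"
    by (simp add: cis_divide algebra_simps)
  finally show ?thesis by simp
qed

lemma circle_elt_cis: "circle_elt (cis (2 * pi * s)) = ex (s *\<^sub>R \<xi>)"
  unfolding circle_elt_def ex_xi_eq_iff
  by (rule unit_complex_eq_cis[symmetric]) simp

lemma circle_elt_in_T [simp]: "circle_elt z \<in> T"
  by (simp add: circle_elt_def ex_xi_in_T)

lemma circle_elt_closed [simp]: "circle_elt z \<in> carrier G"
  by (simp add: circle_elt_def)

lemma circle_elt_mult:
  assumes "norm z = 1" "norm w = 1"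
  shows "circle_elt (z * w) = circle_elt z \<otimes> circle_elt w"
proof -
  obtain s t where [simp]: "z = cis (2 * pi * s)" "w = cis (2 * pi * t)"
    using unit_complex_eq_cis assms by blast
  have "circle_elt (z * w) = circle_elt (cis (2 * pi * (s + t)))"
    by (simp add: cis_mult algebra_simps)
  then show ?thesis by (simp only: circle_elt_cis) (simp add: circle_elt_cis scaleR_add_left ex_add)
qed

lemma circle_elt_inj:
  assumes "norm z = 1" "norm w = 1" "circle_elt z = circle_elt w"
  shows "z = w"
proof -
  obtain s t where "z = cis (2 * pi * s)" "w = cis (2 * pi * t)"
    using unit_complex_eq_cis assms(1,2) by blast
  with assms(3) show ?thesis by (simp add: circle_elt_cis ex_xi_eq_iff)
qed

lemma circle_elt_surj:
  assumes "t \<in> T"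
  obtains z where "norm z = 1" "t = circle_elt z"
proof -
  obtain s where "t = ex (s *\<^sub>R \<xi>)" using assms T_eq by auto
  then show ?thesis using that[of "cis (2 * pi * s)"] by (simp add: circle_elt_cis)
qed

section \<open>Weights of characters on the circle\<close>

definition has_weight :: "('g \<Rightarrow> complex) \<Rightarrow> int \<Rightarrow> bool" where
  "has_weight \<psi> k \<longleftrightarrow> (\<forall>z. norm z = 1 \<longrightarrow> \<psi> (circle_elt z) = z powi k)"

text \<open>Along the one-parameter subgroup the character is s \<mapsto> cis (a s), and
  \<open>ex \<xi> = \<one>\<close> forces a to be an integral multiple of 2 pi.\<close>

lemma characters_has_weight:
  assumes "\<psi> \<in> characters G X"
  obtains k where "has_weight \<psi> k"
proof -
  define h where "h s = \<psi> (ex (s *\<^sub>R \<xi>))" for s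
  have conth: "continuous_on UNIV h"
    unfolding h_def
    by (intro continuous_character_path characters_continuous[OF assms] continuous_intros)
  obtain a where a: "\<And>s. h s = cis (a * s)"
  proof (rule continuous_hom_circle_eq_cis[OF conth])
    show "h (s + t) = h s * h t" for s t
      using characters_mult[OF assms] by (simp add: h_def scaleR_add_left ex_add)
    show "norm (h s) = 1" for s using characters_norm[OF assms] by (simp add: h_def)
  qed blast
  have "h 1 = h 0" by (simp add: h_def xi_in_kernel)
  then have "cis (2 * pi * (a / (2 * pi))) = 1" by (simp add: a)
  then have "a / (2 * pi) \<in> \<int>" by (simp only: cis_2pi_eq_1_iff)
  then obtain k where k: "a / (2 * pi) = of_int k" by (auto simp: Ints_def)
  have "has_weight \<psi> k"
    unfolding has_weight_def
  proof (intro allI impI)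
    fix z :: complex assume "norm z = 1"
    then obtain s where z: "z = cis (2 * pi * s)" using unit_complex_eq_cis by blast
    have "a = 2 * pi * of_int k" using k by (simp add: field_simps)
    then have "h s = cis (2 * pi * (of_int k * s))" by (simp add: a mult_ac)
    then show "\<psi> (circle_elt z) = z powi k"
      unfolding z cis_2pi_powi by (simp add: circle_elt_cis h_def)
  qed
  then show ?thesis by (rule that)
qed

lemma has_weight_mult:
  assumes "has_weight \<psi> k" "has_weight \<psi>' l"
  shows "has_weight (\<lambda>g. \<psi> g * \<psi>' g) (k + l)"
  unfolding has_weight_def
proof (intro allI impI)
  fix z :: complex assume z: "norm z = 1"
  then have "z \<noteq> 0" by auto
  then show "\<psi> (circle_elt z) * \<psi>' (circle_elt z) = z powi (k + l)"
    using assms z by (simp add: has_weight_def power_int_add)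
qed

lemma has_weight_inverse:
  assumes "has_weight \<psi> k"
  shows "has_weight (\<lambda>g. inverse (\<psi> g)) (- k)"
  using assms by (simp add: has_weight_def power_int_minus)

lemma mult_circle_elt:
  assumes "\<psi> \<in> characters G X" "has_weight \<psi> k" "g \<in> carrier G" "norm z = 1"
  shows "\<psi> (g \<otimes> circle_elt z) = \<psi> g * z powi k"
  using characters_mult[OF assms(1,3) circle_elt_closed] assms(2,4) by (simp add: has_weight_def)

section \<open>Cosets of the circle and descent of characters\<close>

lemma topspace_coset_top: "topspace (coset_top G X T) = carrier (G Mod T)"
  by (simp add: coset_top_def topspace_quotient_top carrier_FactGroup topspace_X)

lemma rcos_eqE:
  assumes "T #> g = T #> g'" "g \<in> carrier G" "g' \<in> carrier G"
  obtains t where "t \<in> T" "g = g' \<otimes> t"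
proof -
  have "g \<in> T #> g'" using rcos_self[OF assms(2) subgroup_T] assms(1) by simp
  then obtain t where "t \<in> T" "g = t \<otimes> g'" by (auto simp: r_coset_def)
  then show ?thesis using that[of t] m_comm[of t g'] T_subset assms(3) by auto
qed

lemma rcos_mult_T:
  assumes "g \<in> carrier G" "t \<in> T"
  shows "T #> (g \<otimes> t) = T #> g"
proof -
  have t: "t \<in> carrier G" using assms T_subset by auto
  have "T #> (g \<otimes> t) = T #> (t \<otimes> g)" using m_comm[OF assms(1) t] by simp
  also have "\<dots> = (T #> t) #> g" using coset_mult_assoc[OF T_subset t assms(1)] by simp
  also have "T #> t = T" using coset_join2[OF t subgroup_T assms(2)] .
  finally show ?thesis .
qed

text \<open>Weight 0 means triviality on \<open>T\<close>, so the value does not depend on the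
  representative of the coset; continuity passes through the quotient map.\<close>

lemma character_descends:
  assumes \<psi>: "\<psi> \<in> characters G X" and w: "has_weight \<psi> 0"
  obtains \<psi>' where "\<psi>' \<in> characters (G Mod T) (coset_top G X T)"
    "\<And>g. g \<in> carrier G \<Longrightarrow> \<psi>' (T #> g) = \<psi> g"
proof -
  define \<psi>' where "\<psi>' C = \<psi> (SOME g. g \<in> carrier G \<and> T #> g = C)" for C
  have *: "\<psi>' (T #> g) = \<psi> g" if g: "g \<in> carrier G" for g
  proof -
    define g' where "g' = (SOME g'. g' \<in> carrier G \<and> T #> g' = T #> g)"
    have "g' \<in> carrier G \<and> T #> g' = T #> g"
      unfolding g'_def by (rule someI[of _ g]) (use g in simp)
    then obtain t where t: "t \<in> T" "g' = g \<otimes> t" using rcos_eqE g by metis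
    obtain z where z: "norm z = 1" "t = circle_elt z" using circle_elt_surj[OF t(1)] .
    have "\<psi> g' = \<psi> g" using mult_circle_elt[OF \<psi> w g z(1)] t z by simp
    then show ?thesis by (simp add: \<psi>'_def g'_def)
  qed
  have "continuous_map X euclidean (\<psi>' \<circ> r_coset G T)"
    by (rule continuous_map_eq[OF characters_continuous[OF \<psi>]]) (simp add: * topspace_X)
  then have "continuous_map (coset_top G X T) euclidean \<psi>'"
    unfolding coset_top_def by (rule continuous_compose_quotient_map[OF quotient_map_quotient_top])
  moreover have "\<psi>' \<in> hom (G Mod T) circle_group"
    unfolding hom_def carrier_FactGroup
    using characters_norm[OF \<psi>] characters_mult[OF \<psi>] by (auto simp: * rcos_sum)
  ultimately show ?thesis using that[of \<psi>'] * by (simp add: characters_def)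
qed

text \<open>
  Induction on \<open>I\<close>: by \<open>root_sum_step\<close> the claim for weight \<open>k\<close> is equivalent to the claim for weight
  \<open>k + m i\<close>, and every residue class modulo \<open>m i\<close> contains a weight at which the root sum vanishes
  or, for a single factor, is \<open>sgn (m i)\<close>.
\<close>

lemma root_sum_in_rep_ring:
  fixes \<eta> :: "'i \<Rightarrow> 'g \<Rightarrow> complex"
  assumes "finite I" and "\<And>i. i \<in> I \<Longrightarrow> \<eta> i \<in> characters G X"
    and "\<And>i. i \<in> I \<Longrightarrow> has_weight (\<eta> i) (m i)" and "\<And>i. i \<in> I \<Longrightarrow> m i \<noteq> 0"
    and "\<psi> \<in> characters G X" "has_weight \<psi> k"
  shows "\<exists>h\<in>rep_ring (G Mod T) (coset_top G X T). \<forall>g\<in>carrier G.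
    generic_roots I (\<lambda>i. \<eta> i g) m \<longrightarrow> \<psi> g * root_sum I (\<lambda>i. \<eta> i g) m k = h (T #> g)"
  using assms
proof (induction I arbitrary: \<psi> k rule: finite_induct)
  case empty
  show ?case
    by (rule bexI[OF _ rep_ring_0]) (auto simp: carrier_FactGroup)
next
  case (insert i J)
  let ?R = "rep_ring (G Mod T) (coset_top G X T)"
  let ?S = "\<lambda>g. root_sum (insert i J) (\<lambda>i. \<eta> i g) m"
  have coset: "T #> g \<in> carrier (G Mod T)" if "g \<in> carrier G" for g
    using that by (auto simp: carrier_FactGroup)
  have finI: "finite (insert i J)" using insert.hyps by simp
  have \<eta>i: "\<eta> i \<in> characters G X" "has_weight (\<eta> i) (m i)" "m i \<noteq> 0"
    using insert.prems by auto
  have \<eta>0: "\<eta> j g \<noteq> 0" if "j \<in> insert i J" "g \<in> carrier G" for j g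
    using characters_norm[of "\<eta> j" G X g] insert.prems(1)[of j] that by auto
  \<comment> \<open>Quantifying over all characters of weight \<open>k\<close> lets the factor
    \<eta> i of the recursion be absorbed into \<psi>.\<close>
  define Q where "Q k \<longleftrightarrow> (\<forall>\<psi>. \<psi> \<in> characters G X \<longrightarrow> has_weight \<psi> k \<longrightarrow>
    (\<exists>h\<in>?R. \<forall>g\<in>carrier G. generic_roots (insert i J) (\<lambda>i. \<eta> i g) m \<longrightarrow> \<psi> g * ?S g k = h (T #> g)))" for k
  have IH: "\<exists>h\<in>?R. \<forall>g\<in>carrier G. generic_roots (insert i J) (\<lambda>i. \<eta> i g) m \<longrightarrow>
      \<psi> g * root_sum J (\<lambda>i. \<eta> i g) m k = h (T #> g)"
    if \<psi>: "\<psi> \<in> characters G X" "has_weight \<psi> k" for \<psi> k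
  proof -
    obtain h where h: "h \<in> ?R" "\<forall>g\<in>carrier G. generic_roots J (\<lambda>i. \<eta> i g) m \<longrightarrow>
        \<psi> g * root_sum J (\<lambda>i. \<eta> i g) m k = h (T #> g)"
      using insert.IH[OF insert.prems(1)[OF insertI2] insert.prems(2)[OF insertI2]
          insert.prems(3)[OF insertI2] \<psi>] by blast
    show ?thesis
      by (intro bexI[OF _ h(1)] ballI impI h(2)[rule_format])
        (auto intro: generic_roots_subset[OF _ subset_insertI])
  qed
  have step: "?S g k = \<eta> i g * ?S g (k + m i) + root_sum J (\<lambda>i. \<eta> i g) m k"
    if "generic_roots (insert i J) (\<lambda>i. \<eta> i g) m" for g k
    using root_sum_step[OF finI insertI1 that, of k] insert.hyps by simp
  \<comment> \<open>The recursion as it stands, with \<open>\<psi> g * \<eta> i g\<close> as the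
    character of weight \<open>k + m i\<close>.\<close>
  have down: "Q k" if Q: "Q (k + m i)" for k
    unfolding Q_def
  proof (intro allI impI)
    fix \<psi> assume \<psi>: "\<psi> \<in> characters G X" "has_weight \<psi> k"
    let ?\<psi> = "\<lambda>g. \<psi> g * \<eta> i g"
    have "?\<psi> \<in> characters G X" "has_weight ?\<psi> (k + m i)"
      using times_characters[OF \<psi>(1) \<eta>i(1)] has_weight_mult[OF \<psi>(2) \<eta>i(2)] by auto
    then obtain h1 where h1: "h1 \<in> ?R" "\<And>g. g \<in> carrier G \<Longrightarrow>
        generic_roots (insert i J) (\<lambda>i. \<eta> i g) m \<Longrightarrow> ?\<psi> g * ?S g (k + m i) = h1 (T #> g)"
      using Q unfolding Q_def by meson
    obtain h2 where h2: "h2 \<in> ?R" "\<And>g. g \<in> carrier G \<Longrightarrow>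
        generic_roots (insert i J) (\<lambda>i. \<eta> i g) m \<Longrightarrow> \<psi> g * root_sum J (\<lambda>i. \<eta> i g) m k = h2 (T #> g)"
      using IH[OF \<psi>] by meson
    show "\<exists>h\<in>?R. \<forall>g\<in>carrier G. generic_roots (insert i J) (\<lambda>i. \<eta> i g) m \<longrightarrow> \<psi> g * ?S g k = h (T #> g)"
    proof (intro bexI[OF _ rep_ring_add[OF h1(1) h2(1)]] ballI impI)
      fix g assume g: "g \<in> carrier G" "generic_roots (insert i J) (\<lambda>i. \<eta> i g) m"
      show "\<psi> g * ?S g k = (\<lambda>C\<in>carrier (G Mod T). h1 C + h2 C) (T #> g)"
        using h1(2)[OF g] h2(2)[OF g] coset[OF g(1)] step[OF g(2), of k] by (simp add: algebra_simps)
    qed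
  qed
  \<comment> \<open>The recursion solved for its other root sum: \<psi> is divided by \<eta> i and
    the smaller root sum enters with coefficient -1.\<close>
  have up: "Q (k + m i)" if Q: "Q k" for k
    unfolding Q_def
  proof (intro allI impI)
    fix \<psi> assume \<psi>: "\<psi> \<in> characters G X" "has_weight \<psi> (k + m i)"
    let ?\<psi> = "\<lambda>g. \<psi> g * inverse (\<eta> i g)"
    have \<psi>': "?\<psi> \<in> characters G X" "has_weight ?\<psi> k"
      using times_characters[OF \<psi>(1) inverse_characters[OF \<eta>i(1) topspace_X]]
        has_weight_mult[OF \<psi>(2) has_weight_inverse[OF \<eta>i(2)]] by auto
    then obtain h1 where h1: "h1 \<in> ?R" "\<And>g. g \<in> carrier G \<Longrightarrow>
        generic_roots (insert i J) (\<lambda>i. \<eta> i g) m \<Longrightarrow> ?\<psi> g * ?S g k = h1 (T #> g)"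
      using Q unfolding Q_def by meson
    obtain h2 where h2: "h2 \<in> ?R" "\<And>g. g \<in> carrier G \<Longrightarrow>
        generic_roots (insert i J) (\<lambda>i. \<eta> i g) m \<Longrightarrow> ?\<psi> g * root_sum J (\<lambda>i. \<eta> i g) m k = h2 (T #> g)"
      using IH[OF \<psi>'] by meson
    show "\<exists>h\<in>?R. \<forall>g\<in>carrier G. generic_roots (insert i J) (\<lambda>i. \<eta> i g) m \<longrightarrow>
        \<psi> g * ?S g (k + m i) = h (T #> g)"
    proof (intro bexI[OF _ rep_ring_add[OF h1(1) rep_ring_int_mult[OF h2(1), of "- 1"]]] ballI impI)
      fix g assume g: "g \<in> carrier G" "generic_roots (insert i J) (\<lambda>i. \<eta> i g) m"
      have "\<psi> g * ?S g (k + m i) = ?\<psi> g * (\<eta> i g * ?S g (k + m i))"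
        using \<eta>0[OF _ g(1), of i] by simp
      also have "\<dots> = ?\<psi> g * ?S g k - ?\<psi> g * root_sum J (\<lambda>i. \<eta> i g) m k"
        unfolding step[OF g(2), of k] by (simp only: distrib_left) simp
      finally show "\<psi> g * ?S g (k + m i)
          = (\<lambda>C\<in>carrier (G Mod T). h1 C + (\<lambda>C\<in>carrier (G Mod T). of_int (- 1) * h2 C) C) (T #> g)"
        using h1(2)[OF g] h2(2)[OF g] coset[OF g(1)] by simp
    qed
  qed
  have shift: "Q (k0 + q * m i)" if "Q k0" for k0 q
  proof (induction q rule: int_induct[where k = 0])
    case base
    then show ?case using that by simp
  next
    case (step1 q)
    then show ?case using up[of "k0 + q * m i"] by (simp add: algebra_simps)
  next
    case (step2 q)
    then show ?case using down[of "k0 + (q - 1) * m i"] by (simp add: algebra_simps)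
  qed
  have Q_zero: "Q k" if k: "1 - (\<Sum>j\<in>insert i J. max 0 (- m j)) \<le> k"
    "k \<le> (\<Sum>j\<in>insert i J. \<bar>m j\<bar>) - (\<Sum>j\<in>insert i J. max 0 (- m j)) - 1" for k
    unfolding Q_def
  proof (intro allI impI bexI[OF _ rep_ring_0] ballI)
    fix \<psi> g assume g: "g \<in> carrier G" "generic_roots (insert i J) (\<lambda>i. \<eta> i g) m"
    have "?S g k = 0"
      by (rule root_sum_eq_0[OF finI _ _ g(2) k]) (use \<eta>0 g(1) insert.prems(3) in auto)
    then show "\<psi> g * ?S g k = (\<lambda>C\<in>carrier (G Mod T). 0) (T #> g)"
      using coset[OF g(1)] by simp
  qed
  have "Q k"
  proof (cases "J = {}")
    case True
    \<comment> \<open>\<open>mod\<close> takes the sign of \<open>m i\<close>, so a nonzero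
      remainder lies in the range where the root sum of one factor vanishes.\<close>
    have "Q (k mod m i)"
    proof (cases "k mod m i = 0")
      case True
      have "Q 0"
        unfolding Q_def
      proof (intro allI impI)
        fix \<psi> assume \<psi>: "\<psi> \<in> characters G X" "has_weight \<psi> 0"
        obtain \<psi>' where \<psi>': "\<psi>' \<in> characters (G Mod T) (coset_top G X T)"
          "\<And>g. g \<in> carrier G \<Longrightarrow> \<psi>' (T #> g) = \<psi> g"
          using character_descends[OF \<psi>] by blast
        show "\<exists>h\<in>?R. \<forall>g\<in>carrier G. generic_roots (insert i J) (\<lambda>i. \<eta> i g) m \<longrightarrow>
            \<psi> g * ?S g 0 = h (T #> g)"
        proof (intro bexI[OF _ rep_ring_int_mult[OF rep_ring_character[OF \<psi>'(1)], of "sgn (m i)"]] ballI impI)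
          fix g assume g: "g \<in> carrier G"
          have "?S g 0 = of_int (sgn (m i))"
            unfolding \<open>J = {}\<close> by (rule root_sum_singleton_0) (use \<eta>0 g \<eta>i(3) in auto)
          then show "\<psi> g * ?S g 0 = (\<lambda>C\<in>carrier (G Mod T). of_int (sgn (m i)) *
              (\<lambda>C\<in>carrier (G Mod T). \<psi>' C) C) (T #> g)"
            using coset[OF g] \<psi>'(2)[OF g] by simp
        qed
      qed
      with True show ?thesis by simp
    next
      case False
      show ?thesis
      proof (cases "m i > 0")
        case True
        then have "0 \<le> k mod m i" "k mod m i < m i" by simp_all
        with True False \<open>J = {}\<close> show ?thesis by (intro Q_zero) auto
      next
        case neg: False
        then have "m i < 0" using \<eta>i(3) by simp
        then have "k mod m i \<le> 0" "m i < k mod m i" by (simp_all add: neg_mod_bound)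
        with \<open>m i < 0\<close> False \<open>J = {}\<close> show ?thesis by (intro Q_zero) auto
      qed
    qed
    from shift[OF this, of "k div m i"] show ?thesis by simp
  next
    case False
    then obtain j where j: "j \<in> J" by auto
    \<comment> \<open>The left end of the vanishing range. With a second factor \<open>j\<close> the
      range contains at least \<bar>m i\<bar> consecutive exponents, hence a representative
      \<open>k0\<close> of the class of \<open>k\<close>.\<close>
    define a where "a = 1 - (\<Sum>j\<in>insert i J. max 0 (- m j))"
    define k0 where "k0 = a + (k - a) mod \<bar>m i\<bar>"
    have "\<bar>m j\<bar> \<le> (\<Sum>j\<in>J. \<bar>m j\<bar>)" using insert.hyps j by (intro member_le_sum) auto
    moreover have "\<bar>m j\<bar> \<ge> 1" using insert.prems(3)[of j] j by auto
    moreover have "0 \<le> (k - a) mod \<bar>m i\<bar>" "(k - a) mod \<bar>m i\<bar> < \<bar>m i\<bar>" using \<eta>i(3) by simp_all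
    moreover have "(\<Sum>j\<in>insert i J. \<bar>m j\<bar>) = \<bar>m i\<bar> + (\<Sum>j\<in>J. \<bar>m j\<bar>)" using insert.hyps by simp
    ultimately have "Q k0"
      by (intro Q_zero) (unfold k0_def a_def[symmetric], linarith+, simp add: a_def)
    have "k = k0 + (k - a) div \<bar>m i\<bar> * \<bar>m i\<bar>" unfolding k0_def by simp
    also have "(k - a) div \<bar>m i\<bar> * \<bar>m i\<bar> = (k - a) div \<bar>m i\<bar> * sgn (m i) * m i"
      by (simp add: abs_sgn mult_ac)
    finally show ?thesis using shift[OF \<open>Q k0\<close>, of "(k - a) div \<bar>m i\<bar> * sgn (m i)"] by simp
  qed
  then show ?case using insert.prems(4,5) unfolding Q_def by blast
qed

text \<open>The points of the kernel over the coset of \<open>g\<close> are the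
  \<open>g \<otimes> circle_elt z\<close> with \<open>z\<close> in the root set. The representative
  chosen by \<open>push_forward\<close> is one of them, and averaging over the fibre does not depend
  on which.\<close>

lemma push_forward_kernel:
  assumes \<eta>: "\<eta> \<in> characters G X" "has_weight \<eta> m" "m \<noteq> 0" and g: "g \<in> carrier G"
  shows "push_forward G T (kernel G circle_group \<eta>) h (T #> g) =
    (\<Sum>z\<in>root_set (\<eta> g) m. h (g \<otimes> circle_elt z)) / of_int \<bar>m\<bar>"
proof -
  let ?K = "kernel G circle_group \<eta>" and ?Z = "root_set (\<eta> g) m"
  have b: "norm (\<eta> g) = 1" using characters_norm[OF \<eta>(1) g] .
  then have b0: "\<eta> g \<noteq> 0" by auto
  have unit: "norm z = 1" if "z \<in> ?Z" for z using root_set_norm[OF that b \<eta>(3)] .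
  have inK: "g \<otimes> circle_elt z \<in> ?K \<longleftrightarrow> z \<in> ?Z" if "norm z = 1" for z
    using that mult_circle_elt[OF \<eta>(1,2) g that] g by (auto simp: kernel_def root_set_def)
  define g' where "g' = (SOME g'. g' \<in> ?K \<and> T #> g' = T #> g)"
  have "?Z \<noteq> {}" using card_root_set[OF b0 \<eta>(3)] \<eta>(3) by auto
  then obtain z1 where "z1 \<in> ?Z" by auto
  then have "g \<otimes> circle_elt z1 \<in> ?K \<and> T #> (g \<otimes> circle_elt z1) = T #> g"
    using inK unit rcos_mult_T[OF g] by auto
  then have g': "g' \<in> ?K \<and> T #> g' = T #> g"
    unfolding g'_def by (rule someI)
  then have "g' \<in> carrier G" by (auto simp: kernel_def)
  then obtain t where t: "t \<in> T" "g' = g \<otimes> t" using rcos_eqE g' g by metis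
  obtain z0 where z0: "norm z0 = 1" "t = circle_elt z0" using circle_elt_surj[OF t(1)] .
  have z0Z: "z0 \<in> ?Z" using inK[OF z0(1)] g' t z0 by simp
  have z0_nz: "z0 \<noteq> 0" using z0 by auto
  have g'_mult: "g' \<otimes> circle_elt (z / z0) = g \<otimes> circle_elt z" if "norm z = 1" for z
    using that z0 t g circle_elt_mult[of z0 "z / z0"] z0_nz
    by (simp add: m_assoc norm_divide)
  \<comment> \<open>Dividing the roots by the parameter \<open>z0\<close> of the chosen
    representative gives the parameters of the finite group \<open>?K \<inter> T\<close>.\<close>
  have "bij_betw (\<lambda>z. circle_elt (z / z0)) ?Z (?K \<inter> T)"
    unfolding bij_betw_def
  proof (intro conjI inj_onI equalityI subsetI)
    fix z w assume "z \<in> ?Z" "w \<in> ?Z" "circle_elt (z / z0) = circle_elt (w / z0)"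
    then have "z / z0 = w / z0" using unit z0 by (intro circle_elt_inj) (auto simp: norm_divide)
    then show "z = w" using z0_nz by simp
  next
    fix w assume "w \<in> (\<lambda>z. circle_elt (z / z0)) ` ?Z"
    then obtain z where z: "z \<in> ?Z" and w: "w = circle_elt (z / z0)" by auto
    have "\<eta> w = z powi m / z0 powi m"
      unfolding w using \<eta>(2) unit[OF z] z0 by (simp add: has_weight_def norm_divide power_int_divide_distrib)
    also have "z powi m = z0 powi m"
      using z z0Z b0 by (metis (mono_tags, lifting) mem_Collect_eq mult_left_cancel root_set_def)
    also have "z0 powi m / z0 powi m = 1" using z0_nz by simp
    finally show "w \<in> ?K \<inter> T" by (simp add: w kernel_def)
  next
    fix w assume w: "w \<in> ?K \<inter> T"
    then obtain u where u: "norm u = 1" "w = circle_elt u" using circle_elt_surj by blast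
    have "u powi m = 1" using w u \<eta>(2) by (simp add: kernel_def has_weight_def)
    then have "u * z0 \<in> ?Z" using z0Z u(1) by (auto simp: root_set_def power_int_mult_distrib)
    moreover have "w = circle_elt (u * z0 / z0)" using u z0_nz by simp
    ultimately show "w \<in> (\<lambda>z. circle_elt (z / z0)) ` ?Z" by blast
  qed
  then have sum: "(\<Sum>w\<in>?K \<inter> T. h (g' \<otimes> w)) = (\<Sum>z\<in>?Z. h (g' \<otimes> circle_elt (z / z0)))"
    and card: "card (?K \<inter> T) = card ?Z"
    using sum.reindex_bij_betw[of _ ?Z "?K \<inter> T" "\<lambda>w. h (g' \<otimes> w)"] bij_betw_same_card by fastforce+
  have "of_nat (card ?Z) = (of_int \<bar>m\<bar> :: complex)"
    unfolding card_root_set(1)[OF b0 \<eta>(3)] by simp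
  moreover have "(\<Sum>z\<in>?Z. h (g' \<otimes> circle_elt (z / z0))) = (\<Sum>z\<in>?Z. h (g \<otimes> circle_elt z))"
    by (rule sum.cong) (auto simp: g'_mult unit)
  ultimately show ?thesis
    unfolding push_forward_def g'_def[symmetric] Let_def sum card by simp
qed

section \<open>Characters given by elements of the weight lattice\<close>

lemma weight_char_ex:
  assumes "\<beta> \<in> weight_lattice G ex"
  shows "weight_char ex \<beta> (ex x) = cis (2 * pi * blinfun_apply \<beta> x)"
proof -
  define y where "y = (SOME y. ex y = ex x)"
  have "ex y = ex x" unfolding y_def by (rule someI[of _ x]) simp
  then have "ex (y - x) = \<one>" using ex_add[of y "- x"] by (simp add: ex_uminus)
  then have "blinfun_apply \<beta> (y - x) \<in> \<int>"
    using assms by (auto simp: weight_lattice_def exp_kernel_def)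
  then have "cis (2 * pi * blinfun_apply \<beta> y - 2 * pi * blinfun_apply \<beta> x) = 1"
    by (simp add: cis_2pi_eq_1_iff blinfun.diff_right flip: right_diff_distrib)
  then show ?thesis unfolding weight_char_def y_def[symmetric] by (simp add: cis_divide[symmetric])
qed

lemma weight_char_character:
  assumes "\<beta> \<in> weight_lattice G ex"
  shows "weight_char ex \<beta> \<in> characters G X"
proof -
  have "continuous_map euclidean euclidean (weight_char ex \<beta> \<circ> ex)"
    by (auto simp: o_def weight_char_ex[OF assms] intro!: continuous_intros)
  then have "continuous_map X euclidean (weight_char ex \<beta>)"
    by (rule continuous_compose_quotient_map[OF quotient_ex])
  moreover have "weight_char ex \<beta> \<in> hom G circle_group"
    by (auto simp: hom_def carrier_eq weight_char_ex[OF assms] blinfun.add_right cis_mult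
        distrib_left simp flip: ex_add)
  ultimately show ?thesis by (simp add: characters_def)
qed

lemma weight_xi: "\<beta> \<in> weight_lattice G ex \<Longrightarrow> of_int \<lfloor>blinfun_apply \<beta> \<xi>\<rfloor> = blinfun_apply \<beta> \<xi>"
  using xi_in_kernel by (auto simp: weight_lattice_def exp_kernel_def)

lemma weight_char_weight:
  assumes "\<beta> \<in> weight_lattice G ex"
  shows "has_weight (weight_char ex \<beta>) \<lfloor>blinfun_apply \<beta> \<xi>\<rfloor>"
  unfolding has_weight_def
proof (intro allI impI)
  fix z :: complex assume "norm z = 1"
  then obtain s where z: "z = cis (2 * pi * s)" using unit_complex_eq_cis by blast
  show "weight_char ex \<beta> (circle_elt z) = z powi \<lfloor>blinfun_apply \<beta> \<xi>\<rfloor>"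
    unfolding z circle_elt_cis weight_char_ex[OF assms] cis_2pi_powi weight_xi[OF assms]
    by (simp add: blinfun.scaleR_right mult_ac)
qed

lemma quotient_coset: "quotient_map euclidean (coset_top G X T) (\<lambda>x. T #> ex x)"
  using quotient_map_compose[OF quotient_ex quotient_map_quotient_top]
  by (simp add: coset_top_def o_def)

end

section \<open>The reduced character of a GKM graph\<close>

text \<open>The integers other than \<open>a\<close> keep a positive distance from \<open>a\<close>,
  and \<open>a\<close> itself is attained only at s = 0 because the slope is nonzero.\<close>

lemma eventually_line_notin_Ints:
  fixes a b :: real
  assumes "b \<noteq> 0"
  shows "eventually (\<lambda>s. a + s * b \<notin> \<int>) (at 0)"
proof -
  have "((\<lambda>s. a + s * b) \<longlongrightarrow> a) (at 0)" by (auto intro!: tendsto_eq_intros)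
  moreover have "open (- (\<int> - {a}))" by (intro open_Compl closed_subset_Ints) auto
  ultimately have "eventually (\<lambda>s. a + s * b \<in> - (\<int> - {a})) (at 0)"
    by (rule topological_tendstoD) auto
  moreover have "eventually (\<lambda>s::real. s \<noteq> 0) (at 0)" by (simp add: eventually_at_filter)
  ultimately show ?thesis
    by eventually_elim (use assms in auto)
qed

text \<open>A small move along a vector outside the new hyperplane avoids it, while the earlier
  functionals stay nonzero by continuity.\<close>

lemma exists_not_in_kernels:
  fixes F :: "('a::real_normed_vector \<Rightarrow>\<^sub>L real) set"
  assumes "finite F" "0 \<notin> F"
  shows "\<exists>v. \<forall>\<gamma>\<in>F. blinfun_apply \<gamma> v \<noteq> 0"
  using assms
proof (induction F rule: finite_induct)
  case (insert \<gamma> F)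
  then obtain v where v: "\<forall>\<beta>\<in>F. blinfun_apply \<beta> v \<noteq> 0" by auto
  obtain w where w: "blinfun_apply \<gamma> w \<noteq> 0" using insert.prems by (metis blinfun_eqI insertCI zero_blinfun.rep_eq)
  have "eventually (\<lambda>s. blinfun_apply \<beta> (v + s *\<^sub>R w) \<noteq> 0) (at 0)" if "\<beta> \<in> F" for \<beta>
  proof (rule tendsto_imp_eventually_ne)
    show "((\<lambda>s. blinfun_apply \<beta> (v + s *\<^sub>R w)) \<longlongrightarrow> blinfun_apply \<beta> v) (at 0)"
      by (auto intro!: tendsto_eq_intros)
    show "blinfun_apply \<beta> v \<noteq> 0" using v that by blast
  qed
  then have ev: "eventually (\<lambda>s. \<forall>\<beta>\<in>F. blinfun_apply \<beta> (v + s *\<^sub>R w) \<noteq> 0) (at 0)"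
    by (simp add: eventually_ball_finite insert.hyps)
  have "eventually (\<lambda>s. blinfun_apply \<gamma> v + s * blinfun_apply \<gamma> w \<notin> \<int>) (at 0)"
    by (rule eventually_line_notin_Ints[OF w])
  then have "eventually (\<lambda>s. blinfun_apply \<gamma> (v + s *\<^sub>R w) \<noteq> 0) (at 0)"
    by eventually_elim (auto simp: blinfun.add_right blinfun.scaleR_right)
  with ev have "eventually (\<lambda>s. \<forall>\<beta>\<in>insert \<gamma> F. blinfun_apply \<beta> (v + s *\<^sub>R w) \<noteq> 0) (at 0)"
    by eventually_elim auto
  then show ?case using eventually_happens'[OF trivial_limit_at] by blast
qed auto

section \<open>Characteristic polynomials of sums of one-dimensional representations\<close>

lemma char_poly_1:
  fixes A :: "'b::field mat"
  assumes "A \<in> carrier_mat 1 1"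
  shows "char_poly A = [:- A $$ (0, 0), 1:]"
proof -
  have "upper_triangular A" using assms by (auto simp: upper_triangular_def)
  moreover have "diag_mat A = [A $$ (0, 0)]" using assms by (auto simp: diag_mat_def)
  ultimately show ?thesis using char_poly_upper_triangular[OF assms] by simp
qed

text \<open>Serves to turn an isomorphism of isotropy representations into an equality of products
  over edges.\<close>

lemma char_poly_diag_block_1:
  fixes A :: "'e \<Rightarrow> 'b::field mat"
  assumes "\<And>e. e \<in> set es \<Longrightarrow> A e \<in> carrier_mat 1 1"
  shows "diag_block_mat (map A es) \<in> carrier_mat (length es) (length es) \<and>
    char_poly (diag_block_mat (map A es)) = (\<Prod>e\<leftarrow>es. [:- A e $$ (0, 0), 1:])"
  using assms
proof (induction es)
  case Nil
  have "char_poly (0\<^sub>m 0 0 :: 'b mat) = 1"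
    by (subst char_poly_upper_triangular[of _ 0]) (auto simp: upper_triangular_def diag_mat_def)
  then show ?case by simp
next
  case (Cons e es)
  let ?B = "diag_block_mat (map A es)"
  have A: "A e \<in> carrier_mat 1 1" using Cons.prems by simp
  have B: "?B \<in> carrier_mat (length es) (length es)" using Cons by simp
  have eq: "diag_block_mat (map A (e # es))
      = four_block_mat (A e) (0\<^sub>m 1 (length es)) (0\<^sub>m (length es) 1) ?B"
    using A B by (simp add: Let_def)
  have "four_block_mat (A e) (0\<^sub>m 1 (length es)) (0\<^sub>m (length es) 1) ?B
      \<in> carrier_mat (1 + length es) (1 + length es)"
    using A B by (rule four_block_carrier_mat)
  then show ?case
    unfolding eq char_poly_four_block_zeros_col[OF A zero_carrier_mat B] char_poly_1[OF A]
    using Cons by simp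
qed

section \<open>Edge terms and reversal of edges\<close>

locale gkm_circle_action = circle_in_torus n G X ex T \<xi>
  for n :: nat and G :: "'g monoid" (structure) and X :: "'g topology"
    and ex :: "'a::euclidean_space \<Rightarrow> 'g" and T :: "'g set" and \<xi> :: 'a +
  fixes d :: nat and \<Gamma> :: "('v, 'e) pre_digraph" and rv :: "'e \<Rightarrow> 'e"
    and \<rho> :: "'e \<Rightarrow> 'g \<Rightarrow> complex mat" and \<alpha> :: "'e \<Rightarrow> ('a \<Rightarrow>\<^sub>L real)"
    and \<tau> :: "'v \<Rightarrow> 'g \<Rightarrow> complex mat" and \<phi> :: "'v \<Rightarrow> real" and f :: "'v \<Rightarrow> 'g \<Rightarrow> complex"
  assumes graph: "valent_graph d \<Gamma> rv"
    and action: "graph_action G X ex d \<Gamma> rv \<rho> \<alpha> \<tau>"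
    and gkm: "gkm \<Gamma> \<alpha>"
    and moment: "moment_map \<Gamma> \<alpha> \<xi> \<phi>"
    and f_in_K: "f \<in> K_ring G X ex \<Gamma> \<alpha>"
begin

sublocale fin_digraph \<Gamma>
  using graph by (simp add: valent_graph_def)

sublocale bidirected_digraph \<Gamma> rv
  using graph by (simp add: valent_graph_def)

abbreviation \<eta> :: "'e \<Rightarrow> 'g \<Rightarrow> complex" where
  "\<eta> e \<equiv> weight_char ex (\<alpha> e)"

text \<open>On arcs the weight takes an integral value at \<xi>, so the floor only changes the
  type.\<close>

definition m :: "'e \<Rightarrow> int" where
  "m e = \<lfloor>blinfun_apply (\<alpha> e) \<xi>\<rfloor>"

abbreviation K :: "'e \<Rightarrow> 'g set" where
  "K \<equiv> edge_group G ex \<alpha>"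

abbreviation sharp :: "'e \<Rightarrow> 'g set \<Rightarrow> complex" where
  "sharp \<equiv> f_sharp G ex T \<Gamma> \<alpha> f"

lemma weight: "e \<in> arcs \<Gamma> \<Longrightarrow> \<alpha> e \<in> weight_lattice G ex"
  using action by (simp add: graph_action_def)

lemma eta_character: "e \<in> arcs \<Gamma> \<Longrightarrow> \<eta> e \<in> characters G X"
  and eta_weight: "e \<in> arcs \<Gamma> \<Longrightarrow> has_weight (\<eta> e) (m e)"
  and eta_ex: "e \<in> arcs \<Gamma> \<Longrightarrow> \<eta> e (ex x) = cis (2 * pi * blinfun_apply (\<alpha> e) x)"
  and of_int_m: "e \<in> arcs \<Gamma> \<Longrightarrow> of_int (m e) = blinfun_apply (\<alpha> e) \<xi>"
  using weight_char_character weight_char_weight weight_char_ex weight_xi weight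
  by (auto simp: m_def)

lemma sgn_m: "e \<in> arcs \<Gamma> \<Longrightarrow> real_of_int (sgn (m e)) = sgn (\<phi> (head \<Gamma> e) - \<phi> (tail \<Gamma> e))"
proof -
  assume e: "e \<in> arcs \<Gamma>"
  have "(\<phi> (head \<Gamma> e) - \<phi> (tail \<Gamma> e)) / of_int (m e) > 0"
    using moment e by (simp add: moment_map_def of_int_m)
  then show ?thesis by (auto simp: zero_less_divide_iff sgn_if)
qed

lemma m_nonzero: "e \<in> arcs \<Gamma> \<Longrightarrow> m e \<noteq> 0"
  using moment by (force simp: moment_map_def simp flip: of_int_m)

lemma K_eq: "K e = {g \<in> carrier G. \<eta> e g = 1}"
  by (simp add: edge_group_def kernel_def)

lemma ex_in_K_iff: "e \<in> arcs \<Gamma> \<Longrightarrow> ex x \<in> K e \<longleftrightarrow> blinfun_apply (\<alpha> e) x \<in> \<int>"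
  by (simp add: K_eq eta_ex cis_2pi_eq_1_iff)

lemma rho_1: "e \<in> arcs \<Gamma> \<Longrightarrow> g \<in> carrier G \<Longrightarrow>
    \<rho> e g \<in> carrier_mat 1 1 \<and> \<rho> e g $$ (0, 0) = \<eta> e g"
proof -
  assume e: "e \<in> arcs \<Gamma>" and g: "g \<in> carrier G"
  have "\<rho> e g \<in> carrier_mat 1 1" "rep_char (\<rho> e) g = \<eta> e g"
    using action e g by (auto simp: graph_action_def is_rep_def)
  then show ?thesis by (auto simp: rep_char_def)
qed

text \<open>By duality \<eta> (rv e) is the inverse of \<eta> e, as seen from characteristic
  polynomials of 1 by 1 matrices; inverse characters have the same kernel.\<close>

lemma K_rv:
  assumes e: "e \<in> arcs \<Gamma>"
  shows "K (rv e) = K e"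
proof -
  have "\<eta> (rv e) g = 1 \<longleftrightarrow> \<eta> e g = 1" if g: "g \<in> carrier G" for g
  proof -
    have "similar_mat (\<rho> (rv e) g) (dual_rep G (\<rho> e) g)"
      using action e g unfolding graph_action_def rep_iso_on_def similar_mat_def by blast
    then have "char_poly (\<rho> (rv e) g) = char_poly (dual_rep G (\<rho> e) g)" by (rule char_poly_similar)
    moreover have "dual_rep G (\<rho> e) g \<in> carrier_mat 1 1"
      "dual_rep G (\<rho> e) g $$ (0, 0) = \<eta> e (inv g)"
      using rho_1[OF e inv_closed[OF g]] by (auto simp: dual_rep_def)
    ultimately have "\<eta> (rv e) g = \<eta> e (inv g)"
      using rho_1[of "rv e" g] e g by (simp add: char_poly_1)
    moreover have "\<eta> e (inv g) * \<eta> e g = \<eta> e \<one>"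
      using characters_mult[OF eta_character[OF e], of "inv g" g] g by simp
    moreover have "\<eta> e \<one> = 1" using eta_ex[OF e, of 0] by simp
    ultimately show ?thesis by auto
  qed
  then show ?thesis unfolding K_eq by blast
qed

lemma char_poly_tau:
  assumes p: "p \<in> verts \<Gamma>" and g: "g \<in> carrier G"
  shows "char_poly (\<tau> p g) = (\<Prod>e\<in>out_arcs \<Gamma> p. [:- \<eta> e g, 1:])"
proof -
  obtain es where es: "distinct es" "set es = out_arcs \<Gamma> p"
    and iso: "rep_iso_on (carrier G) (\<tau> p) (direct_sum_rep (map \<rho> es))"
    using action p unfolding graph_action_def by blast
  have "similar_mat (\<tau> p g) (direct_sum_rep (map \<rho> es) g)"
    using iso g unfolding rep_iso_on_def similar_mat_def by blast
  then have "char_poly (\<tau> p g) = char_poly (diag_block_mat (map (\<lambda>e. \<rho> e g) es))"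
    by (simp add: char_poly_similar direct_sum_rep_def o_def)
  also have "\<dots> = (\<Prod>e\<leftarrow>es. [:- \<rho> e g $$ (0, 0), 1:])"
    using char_poly_diag_block_1[of es "\<lambda>e. \<rho> e g"] rho_1 g es(2) by auto
  also have "\<dots> = (\<Prod>e\<in>set es. [:- \<rho> e g $$ (0, 0), 1:])"
    using es(1) by (simp add: prod.distinct_set_conv_list)
  also have "\<dots> = (\<Prod>e\<in>out_arcs \<Gamma> p. [:- \<eta> e g, 1:])"
    unfolding es(2) using rho_1 g by (intro prod.cong) auto
  finally show ?thesis .
qed

text \<open>On \<open>K e\<close> the isotropy representations at both ends have the same
  characteristic polynomial. Without the factor X - 1 belonging to \<open>e\<close> or
  \<open>rv e\<close>, its value at 1 is the denominator of \<open>f_hat\<close>; the numerators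
  agree by the condition defining \<open>K_ring\<close>.\<close>

lemma sharp_rv:
  assumes e: "e \<in> arcs \<Gamma>"
  shows "sharp (rv e) = sharp e"
proof -
  have "f_hat ex \<Gamma> \<alpha> f (rv e) g = f_hat ex \<Gamma> \<alpha> f e g" if g: "g \<in> K e" for g
  proof -
    let ?p = "tail \<Gamma> e" and ?q = "head \<Gamma> e"
    have gG: "g \<in> carrier G" and 1: "\<eta> e g = 1" using g by (auto simp: K_eq)
    have 2: "\<eta> (rv e) g = 1" using g K_rv[OF e] by (auto simp: K_eq)
    have "restrict (f ?p) (K e) g = restrict (f ?q) (K e) g"
      using f_in_K e by (simp add: K_ring_def)
    then have feq: "f ?p g = f ?q g" using g by simp
    have "similar_mat (\<tau> ?p g) (\<tau> ?q g)"
      using action e g unfolding graph_action_def rep_iso_on_def similar_mat_def by blast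
    then have "char_poly (\<tau> ?p g) = char_poly (\<tau> ?q g)" by (rule char_poly_similar)
    then have "(\<Prod>e'\<in>out_arcs \<Gamma> ?p. [:- \<eta> e' g, 1:]) = (\<Prod>e'\<in>out_arcs \<Gamma> ?q. [:- \<eta> e' g, 1:])"
      using e gG by (simp add: char_poly_tau)
    moreover have "(\<Prod>e'\<in>out_arcs \<Gamma> ?p. [:- \<eta> e' g, 1:])
        = [:- \<eta> e g, 1:] * (\<Prod>e'\<in>out_arcs \<Gamma> ?p - {e}. [:- \<eta> e' g, 1:])"
      using e by (intro prod.remove) auto
    moreover have "(\<Prod>e'\<in>out_arcs \<Gamma> ?q. [:- \<eta> e' g, 1:])
        = [:- \<eta> (rv e) g, 1:] * (\<Prod>e'\<in>out_arcs \<Gamma> ?q - {rv e}. [:- \<eta> e' g, 1:])"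
      using e by (intro prod.remove) auto
    ultimately have "[:- 1, 1:] * (\<Prod>e'\<in>out_arcs \<Gamma> ?p - {e}. [:- \<eta> e' g, 1:])
        = [:- 1, 1:] * (\<Prod>e'\<in>out_arcs \<Gamma> ?q - {rv e}. [:- \<eta> e' g, 1:])"
      unfolding 1 2 by simp
    \<comment> \<open>X - 1 must be cancelled as a polynomial, before the evaluation at 1 where it
      vanishes.\<close>
    then have "(\<Prod>e'\<in>out_arcs \<Gamma> ?p - {e}. [:- \<eta> e' g, 1:]) = (\<Prod>e'\<in>out_arcs \<Gamma> ?q - {rv e}. [:- \<eta> e' g, 1:])"
      by (subst (asm) mult_left_cancel) auto
    from arg_cong[OF this, of "\<lambda>P. poly P 1"]
    have "(\<Prod>e'\<in>out_arcs \<Gamma> ?p - {e}. 1 - \<eta> e' g) = (\<Prod>e'\<in>out_arcs \<Gamma> ?q - {rv e}. 1 - \<eta> e' g)"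
      by (simp add: poly_prod)
    then show ?thesis
      unfolding f_hat_def using e feq by (simp add: prod_inversef[unfolded o_def])
  qed
  then have "restrict (f_hat ex \<Gamma> \<alpha> f (rv e)) (K e) = restrict (f_hat ex \<Gamma> \<alpha> f e) (K e)"
    by (rule restrict_ext)
  then show ?thesis by (intro ext) (simp only: f_sharp_def K_rv[OF e])
qed

lemma sharp_eq:
  assumes e: "e \<in> arcs \<Gamma>" and g: "g \<in> carrier G"
  shows "sharp e (T #> g)
    = (\<Sum>z\<in>root_set (\<eta> e g) (m e). f_hat ex \<Gamma> \<alpha> f e (g \<otimes> circle_elt z)) / of_int \<bar>m e\<bar>"
proof -
  have "sharp e (T #> g) = (\<Sum>z\<in>root_set (\<eta> e g) (m e).
      restrict (f_hat ex \<Gamma> \<alpha> f e) (K e) (g \<otimes> circle_elt z)) / of_int \<bar>m e\<bar>"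
    unfolding f_sharp_def edge_group_def
    by (rule push_forward_kernel[OF eta_character[OF e] eta_weight[OF e] m_nonzero[OF e] g])
  also have "(\<Sum>z\<in>root_set (\<eta> e g) (m e). restrict (f_hat ex \<Gamma> \<alpha> f e) (K e) (g \<otimes> circle_elt z))
    = (\<Sum>z\<in>root_set (\<eta> e g) (m e). f_hat ex \<Gamma> \<alpha> f e (g \<otimes> circle_elt z))"
  proof (rule sum.cong[OF refl])
    fix z assume z: "z \<in> root_set (\<eta> e g) (m e)"
    have "norm z = 1"
      using root_set_norm[OF z characters_norm[OF eta_character[OF e] g] m_nonzero[OF e]] .
    then have "g \<otimes> circle_elt z \<in> K e"
      using mult_circle_elt[OF eta_character[OF e] eta_weight[OF e] g] z g
      by (simp add: K_eq root_set_def)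
    then show "restrict (f_hat ex \<Gamma> \<alpha> f e) (K e) (g \<otimes> circle_elt z) = f_hat ex \<Gamma> \<alpha> f e (g \<otimes> circle_elt z)"
      by simp
  qed
  finally show ?thesis .
qed

section \<open>Vertex sums as root sums\<close>

text \<open>Splitting \<open>f p\<close> into characters of definite weights \<open>w k\<close>
  makes the vertex sum an integral combination of the expressions treated in
  \<open>root_sum_in_rep_ring\<close>.\<close>

lemma vertex_sum_in_rep_ring:
  assumes p: "p \<in> verts \<Gamma>"
  shows "\<exists>h\<in>rep_ring (G Mod T) (coset_top G X T). \<forall>g\<in>carrier G.
    generic_roots (out_arcs \<Gamma> p) (\<lambda>e. \<eta> e g) m \<longrightarrow>
      (\<Sum>e\<in>out_arcs \<Gamma> p. of_int (sgn (m e)) * sharp e (T #> g)) = h (T #> g)"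
proof -
  let ?R = "rep_ring (G Mod T) (coset_top G X T)" and ?I = "out_arcs \<Gamma> p"
  have "f p \<in> rep_ring G X" using f_in_K p by (auto simp: K_ring_def)
  then obtain N c \<psi> where fp: "f p = (\<lambda>x\<in>carrier G. \<Sum>k<(N::nat). of_int (c k) * \<psi> k x)"
    and \<psi>: "\<And>k. k < N \<Longrightarrow> \<psi> k \<in> characters G X"
    unfolding rep_ring_def by blast
  have "\<forall>k. \<exists>w. k < N \<longrightarrow> has_weight (\<psi> k) w" using characters_has_weight[OF \<psi>] by blast
  then obtain w where w: "\<And>k. k < N \<Longrightarrow> has_weight (\<psi> k) (w k)" by metis
  have "\<forall>k. \<exists>h. k < N \<longrightarrow> h \<in> ?R \<and> (\<forall>g\<in>carrier G. generic_roots ?I (\<lambda>e. \<eta> e g) m \<longrightarrow>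
      \<psi> k g * root_sum ?I (\<lambda>e. \<eta> e g) m (w k) = h (T #> g))"
  proof
    fix k
    show "\<exists>h. k < N \<longrightarrow> h \<in> ?R \<and> (\<forall>g\<in>carrier G. generic_roots ?I (\<lambda>e. \<eta> e g) m \<longrightarrow>
        \<psi> k g * root_sum ?I (\<lambda>e. \<eta> e g) m (w k) = h (T #> g))"
    proof (cases "k < N")
      case True
      have "\<exists>h\<in>?R. \<forall>g\<in>carrier G. generic_roots ?I (\<lambda>e. \<eta> e g) m \<longrightarrow>
          \<psi> k g * root_sum ?I (\<lambda>e. \<eta> e g) m (w k) = h (T #> g)"
        by (rule root_sum_in_rep_ring)
          (use \<psi>[OF True] w[OF True] eta_character eta_weight m_nonzero in auto)
      then show ?thesis by blast
    qed simp
  qed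
  then obtain h where h: "\<And>k. k < N \<Longrightarrow> h k \<in> ?R"
    and hk: "\<And>k g. k < N \<Longrightarrow> g \<in> carrier G \<Longrightarrow> generic_roots ?I (\<lambda>e. \<eta> e g) m \<Longrightarrow>
      \<psi> k g * root_sum ?I (\<lambda>e. \<eta> e g) m (w k) = h k (T #> g)"
    by metis
  let ?h = "\<lambda>C\<in>carrier (G Mod T). \<Sum>k<N. (\<lambda>C\<in>carrier (G Mod T). of_int (c k) * h k C) C"
  have "?h \<in> ?R" by (intro rep_ring_sum rep_ring_int_mult h) auto
  moreover have "(\<Sum>e\<in>?I. of_int (sgn (m e)) * sharp e (T #> g)) = ?h (T #> g)"
    if g: "g \<in> carrier G" and gen: "generic_roots ?I (\<lambda>e. \<eta> e g) m" for g
  proof -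
    have "of_int (sgn (m e)) * sharp e (T #> g) = (\<Sum>k<N. of_int (c k) * (\<psi> k g *
        ((\<Sum>z\<in>root_set (\<eta> e g) (m e). z powi w k * (\<Prod>e'\<in>?I - {e}. inverse (1 - \<eta> e' g * z powi m e')))
          / of_int (m e))))" if e: "e \<in> ?I" for e
    proof -
      have eA: "e \<in> arcs \<Gamma>" "tail \<Gamma> e = p" using e by auto
      have hat: "f_hat ex \<Gamma> \<alpha> f e (g \<otimes> circle_elt z) = (\<Sum>k<N. of_int (c k) * (\<psi> k g *
          (z powi w k * (\<Prod>e'\<in>?I - {e}. inverse (1 - \<eta> e' g * z powi m e')))))"
        if z: "z \<in> root_set (\<eta> e g) (m e)" for z
      proof -
        have nz: "norm z = 1"
          using root_set_norm[OF z characters_norm[OF eta_character[OF eA(1)] g] m_nonzero[OF eA(1)]] .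
        have "f p (g \<otimes> circle_elt z) = (\<Sum>k<N. of_int (c k) * (\<psi> k g * z powi w k))"
          unfolding fp using g mult_circle_elt[OF \<psi> w g nz] by simp
        moreover have "(\<Prod>e'\<in>?I - {e}. inverse (1 - \<eta> e' (g \<otimes> circle_elt z)))
            = (\<Prod>e'\<in>?I - {e}. inverse (1 - \<eta> e' g * z powi m e'))"
          using mult_circle_elt[OF eta_character eta_weight g nz] by (intro prod.cong) auto
        ultimately show ?thesis unfolding f_hat_def eA(2) by (simp add: sum_distrib_right mult_ac)
      qed
      \<comment> \<open>The sign turns the order \<bar>m e\<bar> of the averaging group into the
        signed denominator of \<open>root_sum\<close>.\<close>
      have sgn: "of_int (sgn (m e)) / of_int \<bar>m e\<bar> = (1 / of_int (m e) :: complex)"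
        using m_nonzero[OF eA(1)] by (auto simp: sgn_if abs_if)
      have "of_int (sgn (m e)) * sharp e (T #> g)
        = (\<Sum>z\<in>root_set (\<eta> e g) (m e). f_hat ex \<Gamma> \<alpha> f e (g \<otimes> circle_elt z)) * (of_int (sgn (m e)) / of_int \<bar>m e\<bar>)"
        unfolding sharp_eq[OF eA(1) g] by simp
      also have "\<dots> = (\<Sum>z\<in>root_set (\<eta> e g) (m e). \<Sum>k<N. of_int (c k) * (\<psi> k g *
          (z powi w k * (\<Prod>e'\<in>?I - {e}. inverse (1 - \<eta> e' g * z powi m e'))))) / of_int (m e)"
        unfolding sgn by (simp add: hat)
      also have "\<dots> = (\<Sum>k<N. \<Sum>z\<in>root_set (\<eta> e g) (m e). of_int (c k) * (\<psi> k g *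
          (z powi w k * (\<Prod>e'\<in>?I - {e}. inverse (1 - \<eta> e' g * z powi m e'))))) / of_int (m e)"
        by (subst sum.swap) simp
      finally show ?thesis by (simp add: sum_distrib_left sum_divide_distrib)
    qed
    then have "(\<Sum>e\<in>?I. of_int (sgn (m e)) * sharp e (T #> g))
      = (\<Sum>e\<in>?I. \<Sum>k<N. of_int (c k) * (\<psi> k g *
        ((\<Sum>z\<in>root_set (\<eta> e g) (m e). z powi w k * (\<Prod>e'\<in>?I - {e}. inverse (1 - \<eta> e' g * z powi m e')))
          / of_int (m e))))" by (rule sum.cong[OF refl])
    also have "\<dots> = (\<Sum>k<N. of_int (c k) * (\<psi> k g * root_sum ?I (\<lambda>e. \<eta> e g) m (w k)))"
      unfolding root_sum_def sum_distrib_left by (rule sum.swap)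
    also have "\<dots> = (\<Sum>k<N. of_int (c k) * h k (T #> g))"
      by (rule sum.cong) (auto simp: hk[OF _ g gen])
    also have "\<dots> = ?h (T #> g)" using g by (auto simp: carrier_FactGroup intro!: sum.cong)
    finally show ?thesis .
  qed
  ultimately show ?thesis by blast
qed

text \<open>
  Some point \<open>x + s *\<^sub>R \<xi>\<close> lies over \<open>G\<^sub>e \<inter> G\<^sub>e\<^sub>'\<close> iff \<open>pair_weight e e'\<close> takes at \<open>x\<close> a value in
  \<open>pair_values e e'\<close>; this makes the bad locus in \<open>G/T\<close> the image of a closed set of hyperplanes.
\<close>

definition pair_weight :: "'e \<Rightarrow> 'e \<Rightarrow> ('a \<Rightarrow>\<^sub>L real)" where
  "pair_weight e e' = of_int (m e) *\<^sub>R \<alpha> e' - of_int (m e') *\<^sub>R \<alpha> e"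

definition pair_values :: "'e \<Rightarrow> 'e \<Rightarrow> real set" where
  "pair_values e e' = {of_int (m e * k' - m e' * k) | k k'. True}"

definition adjacent_pairs :: "('e \<times> 'e) set" where
  "adjacent_pairs = {(e, e') \<in> arcs \<Gamma> \<times> arcs \<Gamma>. e \<noteq> e' \<and> tail \<Gamma> e = tail \<Gamma> e'}"

text \<open>Stronger than lying over the domain of the edges that cross \<open>c\<close>: pairs at
  all vertices count, and all integers are excluded instead of \<open>pair_values\<close> only. This
  makes the poles simple at every vertex.\<close>

definition generic_point :: "'a \<Rightarrow> bool" where
  "generic_point x \<longleftrightarrow> (\<forall>(e, e')\<in>adjacent_pairs. blinfun_apply (pair_weight e e') x \<notin> \<int>)"

lemma pair_values_Ints: "pair_values e e' \<subseteq> \<int>"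
  by (auto simp: pair_values_def)

lemma finite_adjacent_pairs: "finite adjacent_pairs"
  by (rule finite_subset[of _ "arcs \<Gamma> \<times> arcs \<Gamma>"]) (auto simp: adjacent_pairs_def)

text \<open>If it were zero, \<open>\<alpha> e'\<close> would be a multiple of
  \<open>\<alpha> e\<close>, against the GKM condition.\<close>

lemma pair_weight_nonzero:
  assumes "(e, e') \<in> adjacent_pairs"
  shows "pair_weight e e' \<noteq> 0"
proof
  assume 0: "pair_weight e e' = 0"
  have e: "e \<in> arcs \<Gamma>" and ne: "\<alpha> e \<noteq> \<alpha> e'" and ind: "independent {\<alpha> e', \<alpha> e}"
    using gkm assms by (auto simp: gkm_def adjacent_pairs_def insert_commute)
  have "\<alpha> e' = (1 / of_int (m e)) *\<^sub>R (of_int (m e) *\<^sub>R \<alpha> e')" using m_nonzero[OF e] by simp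
  also have "of_int (m e) *\<^sub>R \<alpha> e' = of_int (m e') *\<^sub>R \<alpha> e" using 0 by (simp add: pair_weight_def)
  finally have "\<alpha> e' \<in> span {\<alpha> e}" by (metis insertI1 span_base span_scale)
  then show False using ind ne by (simp add: independent_insert split: if_splits)
qed

text \<open>Points over the coset have the form ex (x + s \<xi>). Both characters are 1 there iff
  both weights are integral at x + s \<xi>, and eliminating s from these two conditions gives the
  value of \<open>pair_weight\<close>.\<close>

lemma sharp_domain_iff:
  assumes e: "e \<in> arcs \<Gamma>"
  shows "T #> ex x \<in> sharp_domain G ex T \<Gamma> \<alpha> e \<longleftrightarrow>
    (\<forall>e'\<in>out_arcs \<Gamma> (tail \<Gamma> e) - {e}. blinfun_apply (pair_weight e e') x \<notin> pair_values e e')"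
proof -
  have carr: "T #> ex x \<in> carrier (G Mod T)" by (simp add: carrier_FactGroup)
  have m0: "real_of_int (m e) \<noteq> 0" using m_nonzero[OF e] by simp
  have "(\<exists>g\<in>K e. T #> g = T #> ex x \<and> \<eta> e' g = 1) \<longleftrightarrow>
      blinfun_apply (pair_weight e e') x \<in> pair_values e e'"
    if "e' \<in> out_arcs \<Gamma> (tail \<Gamma> e) - {e}" for e'
  proof
    have e': "e' \<in> arcs \<Gamma>" using that by auto
    have \<alpha>xi: "blinfun_apply (\<alpha> e) (x + s *\<^sub>R \<xi>) = blinfun_apply (\<alpha> e) x + s * of_int (m e)"
      "blinfun_apply (\<alpha> e') (x + s *\<^sub>R \<xi>) = blinfun_apply (\<alpha> e') x + s * of_int (m e')" for s
      by (simp_all add: blinfun.add_right blinfun.scaleR_right of_int_m e e')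
    have \<eta>1: "\<eta> e' (ex y) = 1 \<longleftrightarrow> blinfun_apply (\<alpha> e') y \<in> \<int>" for y
      by (simp add: eta_ex[OF e'] cis_2pi_eq_1_iff)
    have pw: "blinfun_apply (pair_weight e e') x
        = of_int (m e) * blinfun_apply (\<alpha> e') x - of_int (m e') * blinfun_apply (\<alpha> e) x"
      by (simp add: pair_weight_def blinfun.diff_left blinfun.scaleR_left)
    {
      assume "\<exists>g\<in>K e. T #> g = T #> ex x \<and> \<eta> e' g = 1"
      then obtain g where g: "g \<in> K e" "T #> g = T #> ex x" "\<eta> e' g = 1" by blast
      then obtain t where t: "t \<in> T" "g = ex x \<otimes> t" using rcos_eqE[of g "ex x"] by (auto simp: K_eq)
      then obtain s where "t = ex (s *\<^sub>R \<xi>)" using T_eq by auto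
      then have gs: "g = ex (x + s *\<^sub>R \<xi>)" using t by (simp add: ex_add)
      obtain k k' where "blinfun_apply (\<alpha> e) x + s * of_int (m e) = of_int k"
        and "blinfun_apply (\<alpha> e') x + s * of_int (m e') = of_int k'"
        using g(1,3) unfolding gs ex_in_K_iff[OF e] \<eta>1 \<alpha>xi by (auto elim!: Ints_cases)
      then have \<alpha>x: "blinfun_apply (\<alpha> e) x = of_int k - s * of_int (m e)"
        "blinfun_apply (\<alpha> e') x = of_int k' - s * of_int (m e')" by simp_all
      have "blinfun_apply (pair_weight e e') x = of_int (m e * k' - m e' * k)"
        unfolding pw \<alpha>x by (simp add: algebra_simps)
      then show "blinfun_apply (pair_weight e e') x \<in> pair_values e e'"
        unfolding pair_values_def by blast
    }
    {
      assume "blinfun_apply (pair_weight e e') x \<in> pair_values e e'"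
      then obtain k k' where k: "blinfun_apply (pair_weight e e') x = of_int (m e * k' - m e' * k)"
        unfolding pair_values_def by blast
      \<comment> \<open>Solves the condition for \<open>\<alpha> e\<close>; the one for
        \<open>\<alpha> e'\<close> then follows from the value of
        \<open>pair_weight\<close>.\<close>
      define s where "s = (of_int k - blinfun_apply (\<alpha> e) x) / of_int (m e)"
      have 1: "blinfun_apply (\<alpha> e) (x + s *\<^sub>R \<xi>) = of_int k" unfolding \<alpha>xi s_def using m0 by simp
      have 2: "blinfun_apply (\<alpha> e') (x + s *\<^sub>R \<xi>) = of_int k'"
        using k m0 unfolding \<alpha>xi s_def pw by (simp add: field_simps)
      have "ex (x + s *\<^sub>R \<xi>) \<in> K e" "\<eta> e' (ex (x + s *\<^sub>R \<xi>)) = 1"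
        unfolding ex_in_K_iff[OF e] \<eta>1 1 2 by simp_all
      moreover have "T #> ex (x + s *\<^sub>R \<xi>) = T #> ex x"
        unfolding ex_add by (rule rcos_mult_T) (simp_all add: ex_xi_in_T)
      ultimately show "\<exists>g\<in>K e. T #> g = T #> ex x \<and> \<eta> e' g = 1" by blast
    }
  qed
  then show ?thesis unfolding sharp_domain_def using carr by blast
qed

lemma generic_point_sharp_domain:
  assumes "generic_point x" "e \<in> arcs \<Gamma>"
  shows "T #> ex x \<in> sharp_domain G ex T \<Gamma> \<alpha> e"
  unfolding sharp_domain_iff[OF assms(2)]
  using assms pair_values_Ints by (fastforce simp: generic_point_def adjacent_pairs_def)

text \<open>A common root \<open>z\<close> would give the point
  \<open>ex x \<otimes> circle_elt z\<close> of both edge groups, over a coset in the domain of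
  \<open>e\<close>.\<close>

lemma generic_point_roots:
  assumes "generic_point x"
  shows "generic_roots (out_arcs \<Gamma> p) (\<lambda>e. \<eta> e (ex x)) m"
  unfolding generic_roots_def
proof (intro ballI impI)
  fix e e' assume ee: "e \<in> out_arcs \<Gamma> p" "e' \<in> out_arcs \<Gamma> p" "e \<noteq> e'"
  then have e: "e \<in> arcs \<Gamma>" and e': "e' \<in> arcs \<Gamma>" by auto
  show "root_set (\<eta> e (ex x)) (m e) \<inter> root_set (\<eta> e' (ex x)) (m e') = {}"
  proof (rule ccontr)
    assume "\<not> ?thesis"
    then obtain z where z: "z \<in> root_set (\<eta> e (ex x)) (m e)" "z \<in> root_set (\<eta> e' (ex x)) (m e')" by blast
    have nz: "norm z = 1"
      using root_set_norm[OF z(1) characters_norm[OF eta_character[OF e] ex_closed] m_nonzero[OF e]] .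
    let ?g = "ex x \<otimes> circle_elt z"
    have "\<eta> e ?g = 1" "\<eta> e' ?g = 1"
      using z mult_circle_elt[OF eta_character eta_weight ex_closed nz] e e' by (auto simp: root_set_def)
    moreover have "T #> ?g = T #> ex x" by (rule rcos_mult_T) simp_all
    ultimately show False
      using generic_point_sharp_domain[OF assms e] ee unfolding sharp_domain_def by (auto simp: K_eq)
  qed
qed

text \<open>One direction transverse to all the hyperplanes serves every base point; both the
  density of the domain and the final limit rest on it.\<close>

lemma exists_generic_direction:
  obtains v where "\<And>x. eventually (\<lambda>s. generic_point (x + s *\<^sub>R v)) (at 0)"
proof -
  let ?F = "(\<lambda>(e, e'). pair_weight e e') ` adjacent_pairs"
  have "finite ?F" "0 \<notin> ?F" using finite_adjacent_pairs pair_weight_nonzero by force+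
  then obtain v where v: "\<forall>\<gamma>\<in>?F. blinfun_apply \<gamma> v \<noteq> 0" using exists_not_in_kernels by blast
  have "eventually (\<lambda>s. generic_point (x + s *\<^sub>R v)) (at 0)" for x
    unfolding generic_point_def
  proof (intro eventually_ball_finite finite_adjacent_pairs ballI, clarify)
    fix e e' assume "(e, e') \<in> adjacent_pairs"
    then have "blinfun_apply (pair_weight e e') v \<noteq> 0" using v by force
    from eventually_line_notin_Ints[OF this, of "blinfun_apply (pair_weight e e') x"]
    show "eventually (\<lambda>s. blinfun_apply (pair_weight e e') (x + s *\<^sub>R v) \<notin> \<int>) (at 0)"
      by (simp add: blinfun.add_right blinfun.scaleR_right)
  qed
  then show ?thesis by (rule that)
qed

text \<open>
  The direction \<open>v\<close> may be changed by a multiple of \<open>\<xi>\<close> without changing the path in \<open>G/T\<close>; choosing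
  it in the kernel of \<open>\<alpha> e\<close> makes the fibre of \<open>G\<^sub>e \<rightarrow> G/T\<close> move by translation.
\<close>

lemma sharp_tendsto:
  assumes e: "e \<in> arcs \<Gamma>" and dom: "T #> ex x \<in> sharp_domain G ex T \<Gamma> \<alpha> e"
  shows "((\<lambda>s. sharp e (T #> ex (x + s *\<^sub>R v))) \<longlongrightarrow> sharp e (T #> ex x)) (at (0::real))"
proof -
  \<comment> \<open>\<open>?a\<close> is the multiple of \<xi> whose removal puts the direction into
    the kernel of \<open>\<alpha> e\<close>.\<close>
  let ?a = "blinfun_apply (\<alpha> e) v / of_int (m e)" and ?Z = "root_set (\<eta> e (ex x)) (m e)"
  define u where "u = v - ?a *\<^sub>R \<xi>"
  have u: "blinfun_apply (\<alpha> e) u = 0"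
    using m_nonzero[OF e] by (simp add: u_def blinfun.diff_right blinfun.scaleR_right of_int_m[OF e, symmetric])
  have coset: "T #> ex (x + s *\<^sub>R v) = T #> ex (x + s *\<^sub>R u)" for s
  proof -
    have "ex (x + s *\<^sub>R v) = ex (x + s *\<^sub>R u) \<otimes> ex ((s * ?a) *\<^sub>R \<xi>)"
      by (simp add: u_def scaleR_diff_right flip: ex_add)
    then show ?thesis by (simp add: rcos_mult_T ex_xi_in_T)
  qed
  define F where "F s = (\<Sum>z\<in>?Z. f_hat ex \<Gamma> \<alpha> f e (ex (x + s *\<^sub>R u) \<otimes> circle_elt z)) / of_int \<bar>m e\<bar>" for s :: real
  have eq: "sharp e (T #> ex (x + s *\<^sub>R v)) = F s" for s
  proof -
    \<comment> \<open>The index set of the sum is therefore independent of \<open>s\<close>, and the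
      limit may be taken term by term.\<close>
    have "\<eta> e (ex (x + s *\<^sub>R u)) = \<eta> e (ex x)"
      by (simp add: eta_ex[OF e] blinfun.add_right blinfun.scaleR_right u)
    then show ?thesis unfolding coset F_def sharp_eq[OF e ex_closed] by simp
  qed
  have "(F \<longlongrightarrow> F 0) (at 0)"
    unfolding F_def f_hat_def
  proof (intro tendsto_divide tendsto_sum tendsto_mult tendsto_prod tendsto_inverse tendsto_diff tendsto_const)
    fix z assume z: "z \<in> ?Z"
    have nz: "norm z = 1"
      using root_set_norm[OF z characters_norm[OF eta_character[OF e] ex_closed] m_nonzero[OF e]] .
    have path: "((\<lambda>s. \<psi> (ex (x + s *\<^sub>R u) \<otimes> circle_elt z)) \<longlongrightarrow> \<psi> (ex (x + 0 *\<^sub>R u) \<otimes> circle_elt z)) (at 0)"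
      if "continuous_map X euclidean \<psi>" for \<psi> :: "'g \<Rightarrow> complex"
    proof -
      have "continuous_on UNIV (\<lambda>s::real. \<psi> (ex (x + s *\<^sub>R u + (Arg z / (2 * pi)) *\<^sub>R \<xi>)))"
        by (rule continuous_character_path[OF that]) (intro continuous_intros)
      then have "isCont (\<lambda>s::real. \<psi> (ex (x + s *\<^sub>R u) \<otimes> circle_elt z)) 0"
        by (simp add: circle_elt_def ex_add continuous_on_eq_continuous_at)
      then show ?thesis by (simp add: isCont_def)
    qed
    have "f (tail \<Gamma> e) \<in> rep_ring G X" using f_in_K e by (auto simp: K_ring_def)
    then show "((\<lambda>s. f (tail \<Gamma> e) (ex (x + s *\<^sub>R u) \<otimes> circle_elt z)) \<longlongrightarrow>
        f (tail \<Gamma> e) (ex (x + 0 *\<^sub>R u) \<otimes> circle_elt z)) (at 0)"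
      using topspace_X by (intro path rep_ring_continuous)
    fix e' assume e': "e' \<in> out_arcs \<Gamma> (tail \<Gamma> e) - {e}"
    show "((\<lambda>s. \<eta> e' (ex (x + s *\<^sub>R u) \<otimes> circle_elt z)) \<longlongrightarrow>
        \<eta> e' (ex (x + 0 *\<^sub>R u) \<otimes> circle_elt z)) (at 0)"
      using e' by (intro path characters_continuous[OF eta_character]) auto
    have "\<eta> e (ex x \<otimes> circle_elt z) = 1"
      using z mult_circle_elt[OF eta_character eta_weight ex_closed nz] e by (auto simp: root_set_def)
    moreover have "T #> (ex x \<otimes> circle_elt z) = T #> ex x" by (rule rcos_mult_T) simp_all
    ultimately have "\<eta> e' (ex x \<otimes> circle_elt z) \<noteq> 1"
      using dom e' unfolding sharp_domain_def by (auto simp: K_eq)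
    then show "1 - \<eta> e' (ex (x + 0 *\<^sub>R u) \<otimes> circle_elt z) \<noteq> 0" by simp
  qed (use m_nonzero[OF e] in simp)
  moreover have "F 0 = sharp e (T #> ex x)" using eq[of 0] by simp
  ultimately show ?thesis by (simp add: eq)
qed

text \<open>The edges with both ends below \<open>c\<close> cancel in pairs \<open>e, rv e\<close>.\<close>

lemma chi_c_eq_vertex_sum:
  assumes c: "regular_value \<Gamma> \<phi> c"
  shows "chi_c G ex T \<Gamma> \<alpha> \<phi> c f C
    = (\<Sum>p\<in>{p \<in> verts \<Gamma>. \<phi> p < c}. \<Sum>e\<in>out_arcs \<Gamma> p. of_int (sgn (m e)) * sharp e C)"
proof -
  let ?F = "\<lambda>e. of_int (sgn (m e)) * sharp e C"
  let ?V = "cross_section \<Gamma> \<phi> c" and ?B = "{e \<in> arcs \<Gamma>. \<phi> (tail \<Gamma> e) < c \<and> \<phi> (head \<Gamma> e) < c}"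
  have "(\<Sum>p\<in>{p \<in> verts \<Gamma>. \<phi> p < c}. \<Sum>e\<in>out_arcs \<Gamma> p. ?F e)
      = sum ?F (\<Union>p\<in>{p \<in> verts \<Gamma>. \<phi> p < c}. out_arcs \<Gamma> p)"
    by (rule sum.UNION_disjoint[symmetric]) auto
  \<comment> \<open>An edge starting below \<open>c\<close> ends above or below it, as a regular
    value is not attained at a vertex.\<close>
  also have "(\<Union>p\<in>{p \<in> verts \<Gamma>. \<phi> p < c}. out_arcs \<Gamma> p) = ?V \<union> ?B"
  proof -
    have "\<phi> (head \<Gamma> e) \<noteq> c" if "e \<in> arcs \<Gamma>" for e
      using c head_in_verts[OF that] by (auto simp: regular_value_def)
    then have "e \<in> (\<Union>p\<in>{p \<in> verts \<Gamma>. \<phi> p < c}. out_arcs \<Gamma> p) \<longleftrightarrow> e \<in> ?V \<union> ?B" for e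
      using linorder_less_linear[of "\<phi> (head \<Gamma> e)" c] by (auto simp: cross_section_def)
    then show ?thesis by blast
  qed
  also have "sum ?F (?V \<union> ?B) = sum ?F ?V + sum ?F ?B"
    by (rule sum.union_disjoint) (auto simp: cross_section_def)
  also have "sum ?F ?B = 0"
  proof -
    have "bij_betw rv ?B ?B"
      by (rule bij_betwI[of _ _ _ rv]) auto
    then have "sum ?F ?B = (\<Sum>e\<in>?B. ?F (rv e))" by (rule sum.reindex_bij_betw[symmetric])
    also have "\<dots> = (\<Sum>e\<in>?B. - ?F e)"
    proof (rule sum.cong[OF refl])
      fix e assume "e \<in> ?B"
      then have e: "e \<in> arcs \<Gamma>" by simp
      have "real_of_int (sgn (m (rv e))) = real_of_int (- sgn (m e))"
        using sgn_m[of "rv e"] sgn_m[of e] e by (simp add: sgn_if)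
      then have "sgn (m (rv e)) = - sgn (m e)" by (simp only: of_int_eq_iff)
      then show "?F (rv e) = - ?F e" by (simp add: sharp_rv[OF e])
    qed
    finally show ?thesis by (simp add: sum_negf)
  qed
  also have "sum ?F ?V = chi_c G ex T \<Gamma> \<alpha> \<phi> c f C"
    unfolding chi_c_def
  proof (rule sum.cong[OF refl])
    fix e assume "e \<in> ?V"
    then have e: "e \<in> arcs \<Gamma>" "\<phi> (tail \<Gamma> e) < \<phi> (head \<Gamma> e)" by (auto simp: cross_section_def)
    then have "real_of_int (sgn (m e)) = real_of_int 1" using sgn_m[of e] by simp
    then have "sgn (m e) = 1" by (simp only: of_int_eq_iff)
    then show "?F e = sharp e C" by simp
  qed
  finally show ?thesis by simp
qed

section \<open>The reduced character as an element of the character ring\<close>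

lemma chi_c_generically_in:
  assumes c: "regular_value \<Gamma> \<phi> c"
  shows "generically_in (coset_top G X T) (chi_domain G ex T \<Gamma> \<alpha> \<phi> c)
           (chi_c G ex T \<Gamma> \<alpha> \<phi> c f) (rep_ring (G Mod T) (coset_top G X T))"
proof -
  let ?Y = "coset_top G X T" and ?D = "chi_domain G ex T \<Gamma> \<alpha> \<phi> c" and ?V = "cross_section \<Gamma> \<phi> c"
  let ?R = "rep_ring (G Mod T) (coset_top G X T)" and ?q = "\<lambda>x. T #> ex x"
  have VA: "?V \<subseteq> arcs \<Gamma>" and finV: "finite ?V" by (auto simp: cross_section_def)
  have q_in: "?q x \<in> carrier (G Mod T)" for x by (simp add: carrier_FactGroup)
  have q_surj: "\<exists>x. C = ?q x" if "C \<in> carrier (G Mod T)" for C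
    using that by (auto simp: carrier_FactGroup carrier_eq)
  have D_sub: "?D \<subseteq> carrier (G Mod T)" by (auto simp: chi_domain_def)
  have q_D: "?q x \<in> ?D \<longleftrightarrow> (\<forall>e\<in>?V. \<forall>e'\<in>out_arcs \<Gamma> (tail \<Gamma> e) - {e}.
      blinfun_apply (pair_weight e e') x \<notin> pair_values e e')" for x
    unfolding chi_domain_def using q_in[of x] VA sharp_domain_iff[of _ x] by auto
  obtain v where v: "\<And>x. eventually (\<lambda>s. generic_point (x + s *\<^sub>R v)) (at 0)"
    using exists_generic_direction by blast
  have generic_D: "?q x \<in> ?D" if "generic_point x" for x
    using generic_point_sharp_domain[OF that] VA q_in by (auto simp: chi_domain_def)
  have cont_q: "continuous_map euclidean ?Y (\<lambda>s::real. ?q (x + s *\<^sub>R v))" for x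
    using continuous_map_compose[OF _ quotient_imp_continuous_map[OF quotient_coset],
        of euclidean "\<lambda>s::real. x + s *\<^sub>R v"]
    by (simp add: o_def continuous_intros)

  have "open {x. ?q x \<in> ?D}"
  proof -
    \<comment> \<open>Sets of integers are closed, so the complement is a finite union of closed
      sets; openness then passes to G/T through the quotient map.\<close>
    have "{x. ?q x \<in> ?D} = (\<Inter>e\<in>?V. \<Inter>e'\<in>out_arcs \<Gamma> (tail \<Gamma> e) - {e}.
        blinfun_apply (pair_weight e e') -` (- pair_values e e'))"
      by (auto simp: q_D)
    also have "open \<dots>"
      using finV by (intro open_INT ballI open_vimage open_Compl closed_subset_Ints pair_values_Ints
          continuous_intros) auto
    finally show ?thesis .
  qed
  then have "openin ?Y ?D"
    using quotient_coset D_sub unfolding quotient_map_def topspace_coset_top by simp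

  moreover have "?Y closure_of ?D = topspace ?Y"
  proof (rule equalityI[OF closure_of_subset_topspace], rule subsetI)
    fix C assume "C \<in> topspace ?Y"
    then obtain x where x: "C = ?q x" and C: "C \<in> topspace ?Y"
      using q_surj by (auto simp: topspace_coset_top)
    show "C \<in> ?Y closure_of ?D"
      unfolding in_closure_of
    proof (intro conjI C allI impI)
      fix U assume U: "C \<in> U \<and> openin ?Y U"
      have "open {s::real. ?q (x + s *\<^sub>R v) \<in> U}"
        using openin_continuous_map_preimage[OF cont_q, of U x] U by simp
      moreover have "(0::real) \<in> {s. ?q (x + s *\<^sub>R v) \<in> U}" using U x by simp
      ultimately have "eventually (\<lambda>s. s \<in> {s::real. ?q (x + s *\<^sub>R v) \<in> U}) (at 0)"
        by (rule eventually_at_in_open')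
      with v[of x] have "eventually (\<lambda>s. ?q (x + s *\<^sub>R v) \<in> ?D \<and> ?q (x + s *\<^sub>R v) \<in> U) (at 0)"
        by eventually_elim (auto intro: generic_D)
      then show "\<exists>y. y \<in> ?D \<and> y \<in> U" using eventually_happens'[OF trivial_limit_at] by blast
    qed
  qed

  moreover have "\<exists>h\<in>?R. \<forall>C\<in>?D. chi_c G ex T \<Gamma> \<alpha> \<phi> c f C = h C"
  proof -
    let ?P = "{p \<in> verts \<Gamma>. \<phi> p < c}"
    have "\<forall>p\<in>verts \<Gamma>. \<exists>h. h \<in> ?R \<and> (\<forall>g\<in>carrier G. generic_roots (out_arcs \<Gamma> p) (\<lambda>e. \<eta> e g) m \<longrightarrow>
        (\<Sum>e\<in>out_arcs \<Gamma> p. of_int (sgn (m e)) * sharp e (T #> g)) = h (T #> g))"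
      using vertex_sum_in_rep_ring unfolding Bex_def by (rule ballI)
    from bchoice[OF this] obtain h where h: "\<And>p. p \<in> verts \<Gamma> \<Longrightarrow> h p \<in> ?R"
      and hp: "\<And>p g. p \<in> verts \<Gamma> \<Longrightarrow> g \<in> carrier G \<Longrightarrow> generic_roots (out_arcs \<Gamma> p) (\<lambda>e. \<eta> e g) m \<Longrightarrow>
        (\<Sum>e\<in>out_arcs \<Gamma> p. of_int (sgn (m e)) * sharp e (T #> g)) = h p (T #> g)"
      by blast
    define H where "H = (\<lambda>C\<in>carrier (G Mod T). \<Sum>p\<in>?P. h p C)"
    have HR: "H \<in> ?R" unfolding H_def by (rule rep_ring_sum) (auto intro: h)
    \<comment> \<open>The vertex identities need simple poles at all vertices below
      \<open>c\<close>, so at first only generic points are covered.\<close>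
    have H_generic: "chi_c G ex T \<Gamma> \<alpha> \<phi> c f (?q x) = H (?q x)" if "generic_point x" for x
      unfolding chi_c_eq_vertex_sum[OF c] H_def
      using generic_point_roots[OF that] q_in by (simp add: hp)
    have "chi_c G ex T \<Gamma> \<alpha> \<phi> c f C = H C" if C: "C \<in> ?D" for C
    proof -
      obtain x where x: "C = ?q x" using q_surj C D_sub by blast
      \<comment> \<open>\<open>chi_c\<close> and \<open>H\<close> both converge to their values at
        \<open>C\<close> along the generic direction and agree for small nonzero \<open>s\<close>,
        so they agree at \<open>C\<close>.\<close>
      have "((\<lambda>s. chi_c G ex T \<Gamma> \<alpha> \<phi> c f (?q (x + s *\<^sub>R v))) \<longlongrightarrow> chi_c G ex T \<Gamma> \<alpha> \<phi> c f C) (at (0::real))"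
        unfolding chi_c_def x
        by (intro tendsto_sum sharp_tendsto) (use C VA x in \<open>auto simp: chi_domain_def\<close>)
      moreover have "eventually (\<lambda>s. chi_c G ex T \<Gamma> \<alpha> \<phi> c f (?q (x + s *\<^sub>R v)) = H (?q (x + s *\<^sub>R v))) (at 0)"
        using v[of x] by eventually_elim (rule H_generic)
      ultimately have "((\<lambda>s. H (?q (x + s *\<^sub>R v))) \<longlongrightarrow> chi_c G ex T \<Gamma> \<alpha> \<phi> c f C) (at (0::real))"
        by (rule Lim_transform_eventually)
      moreover have "((\<lambda>s. H (?q (x + s *\<^sub>R v))) \<longlongrightarrow> H C) (at (0::real))"
      proof -
        have "continuous_map euclidean euclidean (H \<circ> (\<lambda>s::real. ?q (x + s *\<^sub>R v)))"
          by (rule continuous_map_compose[OF cont_q rep_ring_continuous[OF HR topspace_coset_top]])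
        then have "isCont (\<lambda>s::real. H (?q (x + s *\<^sub>R v))) 0"
          by (simp add: o_def continuous_on_eq_continuous_at)
        then show ?thesis by (simp add: isCont_def x)
      qed
      ultimately show ?thesis by (rule tendsto_unique[OF trivial_limit_at])
    qed
    with HR show ?thesis by blast
  qed
  ultimately show ?thesis unfolding generically_in_def by blast
qed

end

theorem theorem1p5:
  fixes G :: "'g monoid" and X :: "'g topology" and ex :: "'a::euclidean_space \<Rightarrow> 'g"
    and \<Gamma> :: "('v, 'e) pre_digraph" and rv :: "'e \<Rightarrow> 'e"
    and \<rho> :: "'e \<Rightarrow> 'g \<Rightarrow> complex mat" and \<alpha> :: "'e \<Rightarrow> ('a \<Rightarrow>\<^sub>L real)"
    and \<tau> :: "'v \<Rightarrow> 'g \<Rightarrow> complex mat"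
    and T :: "'g set" and \<xi> :: 'a and \<phi> :: "'v \<Rightarrow> real" and c :: real
    and f :: "'v \<Rightarrow> 'g \<Rightarrow> complex" and n d :: nat
  assumes "torus n G X ex"
    and "valent_graph d \<Gamma> rv"
    and "graph_action G X ex d \<Gamma> rv \<rho> \<alpha> \<tau>"
    and "gkm \<Gamma> \<alpha>"
    and "circle_subgroup G X T"
    and "\<forall>e\<in>arcs \<Gamma>. \<not> T \<subseteq> edge_group G ex \<alpha> e"
    and "infinitesimal_generator G ex T \<xi>"
    and "moment_map \<Gamma> \<alpha> \<xi> \<phi>"
    and "regular_value \<Gamma> \<phi> c"
    and "f \<in> K_ring G X ex \<Gamma> \<alpha>"
  shows "generically_in (coset_top G X T) (chi_domain G ex T \<Gamma> \<alpha> \<phi> c)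
           (chi_c G ex T \<Gamma> \<alpha> \<phi> c f) (rep_ring (G Mod T) (coset_top G X T))"
proof -
  interpret gkm_circle_action n G X ex T \<xi> d \<Gamma> rv \<rho> \<alpha> \<tau> \<phi> f
    by (intro gkm_circle_action.intro circle_in_torus.intro gkm_circle_action_axioms.intro assms)
  show ?thesis by (rule chi_c_generically_in[OF assms(9)])
qed

end
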